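(* Let $\mathcal{P}$ be a basic cell of a lattice $\mathbf{G}\mathbb{Z}^n$ ($\mathbf{G}\in\mathbb{R}^{n\times n}$ full-rank), let $f:\mathbb{R}^n\to[0,\infty)$ be a probability density function such that $L_t^+(f)$ is bounded for every $t>0$, let $\beta:(0,\infty)\to[0,\infty)$ satisfy $L_t^+(f)\subseteq\beta(t)\mathcal{P}$ for every $t>0$, and consider the layered rejection-sampled universal quantizer (LRSUQ) $(P_S,Q_{f,\mathcal{P}})$ for $f$ against $\mathcal{P}$. For a random input $\mathbf{X}$ satisfying $\mathbf{X}\in\mathcal{X}$ almost surely for some $\mathcal{X}\subseteq\mathbb{R}^n$ with $\mu(\mathcal{X})<\infty$, independent of $S\sim P_S$, the conditional entropy of the quantizer satisfies \[ H(Q_{f,\mathcal{P}}(\mathbf{X},S)\,|\,S)\le\mathbb{E}_T\big[\log\mu(\mathcal{X}+3\eta\beta(T)B^n)\big]-h_L(f)+\log e, \] where $T\sim f_T$ with $f_T(t):=\mu(L_t^+(f))$, and $\eta:=\sup_{\mathbf{x}\in\mathcal{P}}\Vert\mathbf{x}\Vert$. Hence, under the assumption that $\mathbb{E}[\log(1+\beta(T))]<\infty$, the normalized entropy satisfies \[ \overline{H}(Q_{f,\mathcal{P}})\le-h_L(f)+\log e. \]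
   Context: Conventions: $\log$ is to base $2$; $H(\cdot|\cdot)$ is conditional Shannon entropy in bits; $\mu$ is Lebesgue measure on $\mathbb{R}^n$; $B^n$ is the closed unit ball; sums of sets are Minkowski sums; sets and functions are measurable as needed. For $f:\mathbb{R}^n\to[0,\infty)$ the superlevel set is $L_t^+(f):=\{\mathbf{z}\in\mathbb{R}^n:f(\mathbf{z})\ge t\}$. The layered entropy of a probability density function $f$ is $h_L(f):=\int_0^\infty\mu(L_t^+(f))\log\mu(L_t^+(f))\,\mathrm{d}t$. A bounded set $\mathcal{P}\subseteq\mathbb{R}^n$ is a basic cell of $\mathbf{G}\mathbb{Z}^n$ if the translates $(\mathcal{P}+\mathbf{G}\mathbf{j})_{\mathbf{j}\in\mathbb{Z}^n}$ partition $\mathbb{R}^n$. For a basic cell $\mathcal{P}$, $Q_{\mathcal{P}}(\mathbf{x})$ is the unique lattice point $\mathbf{y}\in\mathbf{G}\mathbb{Z}^n$ with $\mathbf{x}\in-\mathcal{P}+\mathbf{y}$. LRSUQ for $f$ against $\mathcal{P}$ (with $f,\beta$ as in the claim): the state is $S=(T,(\mathbf{V}_i)_{i\ge1})$, where $T$ has probability density function $f_T(t)=\mu(L_t^+(f))$ on $(0,\infty)$, and $\mathbf{V}_1,\mathbf{V}_2,\ldots$ are i.i.d. $\mathrm{Unif}(\mathcal{P})$, independent of $T$. The quantization function is \[ Q_{f,\mathcal{P}}(\mathbf{x},t,(\mathbf{v}_i)_i):=\beta(t)\cdot\big(Q_{\mathcal{P}}(\mathbf{x}/\beta(t)-\mathbf{v}_k)+\mathbf{v}_k\big),\qquad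 k:=\min\big\{i:\beta(t)\cdot\big(Q_{\mathcal{P}}(\mathbf{x}/\beta(t)-\mathbf{v}_i)+\mathbf{v}_i\big)-\mathbf{x}\in L_t^+(f)\big\}. \] ($\beta(T)>0$ almost surely, and $k$ exists almost surely for each fixed $\mathbf{x}$.) Normalized entropy: $\overline{H}(Q):=\limsup_{\tau\to\infty}\big(H(Q(\mathbf{X}_\tau,S)|S)-\log\mu(\tau B^n)\big)$, where $\mathbf{X}_\tau\sim\mathrm{Unif}(\tau B^n)$ is independent of $S\sim P_S$. *)

theory Defs
  imports "HOL-Probability.Probability"
begin

definition elog2 :: "ennreal \<Rightarrow> ereal" where
  "elog2 x = (if x = 0 then -\<infinity> else if x = \<infinity> then \<infinity> else ereal (log 2 (enn2real x)))"

text \<open>Positive part minus negative part. Where the integral is undefined (both parts infinite),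
  the subtraction of \<^typ>\<open>ereal\<close> gives \<open>\<infinity> - \<infinity> = \<infinity>\<close>.\<close>

definition ext_integral :: "'a measure \<Rightarrow> ('a \<Rightarrow> ereal) \<Rightarrow> ereal" where
  "ext_integral M g =
     enn2ereal (\<integral>\<^sup>+ x. e2ennreal (g x) \<partial>M) - enn2ereal (\<integral>\<^sup>+ x. e2ennreal (- g x) \<partial>M)"

text \<open>The entropy in bits of a discrete distribution; a distribution that is not carried by a
  countable set gets the value \<open>\<infinity>\<close>.\<close>

definition shannon_entropy :: "'b::polish_space measure \<Rightarrow> ennreal" where
  "shannon_entropy D =
     (if \<exists>A. countable A \<and> (AE y in D. y \<in> A)
      then (\<integral>\<^sup>+ y. ennreal (- (measure D {y} * log 2 (measure D {y}))) \<partial>count_space UNIV)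
      else \<infinity>)"

text \<open>\<open>K s\<close> is a regular version of the conditional distribution of \<open>Y\<close> given \<open>S = s\<close>.\<close>

definition is_cond_distr ::
    "'a measure \<Rightarrow> 's measure \<Rightarrow> ('a \<Rightarrow> 'b::polish_space) \<Rightarrow> ('a \<Rightarrow> 's) \<Rightarrow> ('s \<Rightarrow> 'b measure) \<Rightarrow> bool" where
  "is_cond_distr M N Y S K \<longleftrightarrow>
     K \<in> N \<rightarrow>\<^sub>M prob_algebra borel \<and>
     (\<forall>A\<in>sets N. \<forall>B\<in>sets borel.
        emeasure M {\<omega> \<in> space M. S \<omega> \<in> A \<and> Y \<omega> \<in> B} =
          (\<integral>\<^sup>+ s\<in>A. emeasure (K s) B \<partial>distr M N S))"

text \<open>Regular conditional distributions on a Polish space are unique up to a null set of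
  conditions, so the value below does not depend on the chosen version. The library's
  \<open>conditional_entropy\<close> does not apply: it requires densities with respect to a product of
  \<open>\<sigma>\<close>-finite measures, and \<open>Y\<close> is discrete only conditionally on \<open>S\<close>.\<close>

definition cond_entropy ::
    "'a measure \<Rightarrow> 's measure \<Rightarrow> ('a \<Rightarrow> 'b::polish_space) \<Rightarrow> ('a \<Rightarrow> 's) \<Rightarrow> ennreal" where
  "cond_entropy M N Y S =
     (\<integral>\<^sup>+ s. shannon_entropy ((SOME K. is_cond_distr M N Y S K) s) \<partial>distr M N S)"

text \<open>\<open>indep_var\<close> of the library forces both variables to have the same type; this is the
  condition of \<open>indep_var_eq\<close> for two types (the two families are already \<open>\<sigma>\<close>-algebras).\<close>

definition indep_rvs ::
    "'a measure \<Rightarrow> 'b measure \<Rightarrow> ('a \<Rightarrow> 'b) \<Rightarrow> 's measure \<Rightarrow> ('a \<Rightarrow> 's) \<Rightarrow> bool" where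
  "indep_rvs M N1 X N2 Y \<longleftrightarrow>
     X \<in> M \<rightarrow>\<^sub>M N1 \<and> Y \<in> M \<rightarrow>\<^sub>M N2 \<and>
     prob_space.indep_set M {X -` A \<inter> space M | A. A \<in> sets N1} {Y -` A \<inter> space M | A. A \<in> sets N2}"

definition is_pdf :: "('b::euclidean_space \<Rightarrow> real) \<Rightarrow> bool" where
  "is_pdf f \<longleftrightarrow> f \<in> borel_measurable borel \<and> (\<forall>z. 0 \<le> f z) \<and> (\<integral>\<^sup>+ z. ennreal (f z) \<partial>lborel) = 1"

definition superlevel :: "('b::euclidean_space \<Rightarrow> real) \<Rightarrow> real \<Rightarrow> 'b set" where
  "superlevel f t = {z. f z \<ge> t}"

text \<open>For a density \<open>f\<close> and \<open>t > 0\<close> the superlevel set has measure at most \<open>1 / t\<close>, so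
  \<^const>\<open>measure\<close> loses nothing here.\<close>

definition layered_entropy :: "('b::euclidean_space \<Rightarrow> real) \<Rightarrow> ereal" where
  "layered_entropy f =
     ext_integral (restrict_space lborel {0<..})
       (\<lambda>t. ereal (measure lborel (superlevel f t) * log 2 (measure lborel (superlevel f t))))"

definition layer_distr :: "('b::euclidean_space \<Rightarrow> real) \<Rightarrow> real measure" where
  "layer_distr f = density lborel (\<lambda>t. indicator {0<..} t * emeasure lborel (superlevel f t))"

definition lattice_point :: "real^'n^'n \<Rightarrow> int^'n \<Rightarrow> real^'n" where
  "lattice_point G j = G *v (\<chi> i. of_int (j $ i))"

definition basic_cell :: "real^'n^'n \<Rightarrow> (real^'n) set \<Rightarrow> bool" where
  "basic_cell G P \<longleftrightarrow>
     bounded P \<and>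
     disjoint_family (\<lambda>j. P + {lattice_point G j}) \<and>
     (\<Union>j. P + {lattice_point G j}) = UNIV"

definition cell_quantizer :: "real^'n^'n \<Rightarrow> (real^'n) set \<Rightarrow> real^'n \<Rightarrow> real^'n" where
  "cell_quantizer G P x = (THE y. y \<in> range (lattice_point G) \<and> x \<in> uminus ` P + {y})"

text \<open>The i.i.d. sequence is indexed from \<open>0\<close> instead of \<open>1\<close>.\<close>

definition lrsuq_state ::
    "(real^'n) set \<Rightarrow> (real^'n \<Rightarrow> real) \<Rightarrow> (real \<times> (nat \<Rightarrow> real^'n)) measure" where
  "lrsuq_state P f = layer_distr f \<Otimes>\<^sub>M (\<Pi>\<^sub>M i\<in>UNIV. uniform_measure lborel P)"

definition lrsuq ::
    "real^'n^'n \<Rightarrow> (real^'n) set \<Rightarrow> (real^'n \<Rightarrow> real) \<Rightarrow> (real \<Rightarrow> real)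
      \<Rightarrow> real^'n \<Rightarrow> real \<times> (nat \<Rightarrow> real^'n) \<Rightarrow> real^'n" where
  "lrsuq G P f \<beta> x s =
     (let t = fst s; v = snd s;
          y = (\<lambda>i. \<beta> t *\<^sub>R (cell_quantizer G P (x /\<^sub>R \<beta> t - v i) + v i));
          k = (LEAST i. y i - x \<in> superlevel f t)
      in y k)"

definition normalized_entropy ::
    "'s measure \<Rightarrow> ('b::euclidean_space \<Rightarrow> 's \<Rightarrow> 'b) \<Rightarrow> ereal" where
  "normalized_entropy PS Q =
     Limsup at_top (\<lambda>\<tau>::real.
       enn2ereal (cond_entropy (uniform_measure lborel (cball 0 \<tau>) \<Otimes>\<^sub>M PS) PS
                    (\<lambda>(x, s). Q x s) snd)
       - ereal (log 2 (measure lborel (cball (0::'b) \<tau>))))"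

end

theory Submission
  imports Defs
begin

text \<open>
  Fix the state \<open>s = (t, v)\<close>. Let \<open>a\<close> be the probability that a single trial is accepted, namely
  \<open>\<mu>(L\<^sub>t)\<close> divided by the volume of the cell \<open>\<beta>(t) P\<close>. The \<open>k\<close>-th trial always outputs a point of
  a fixed shifted lattice lying within \<open>\<beta>(t) P\<close> of the input set, and by packing translates of
  \<open>\<beta>(t) P\<close> into the dilated input set there are at most \<open>N = a \<mu>(X + 3\<eta>\<beta>(t)B) / \<mu>(L\<^sub>t)\<close> of them.
  By the Gibbs inequality the entropy of the output given \<open>s\<close> is at most its cross entropy relative to
  the distribution that draws a trial number with probabilities proportional to \<open>(1 + a)\<^bsup>-(k+1)\<^esup>\<close> and then a
  candidate point of that trial. This cross entropy is at most
  \<open>log (\<mu>(X + 3\<eta>\<beta>(t)B) / \<mu>(L\<^sub>t)) + E[K] log (1 + a)\<close> for the number \<open>K\<close> of trials; averaging over \<open>v\<close>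
  gives \<open>E[K] \<le> 1 / a\<close>, and \<open>log (1 + a) / a \<le> log e\<close>. Averaging over \<open>t\<close> gives the first bound.
  For a ball of radius \<open>\<tau>\<close> the excess \<open>n log (1 + 3\<eta>\<beta>(t) / \<tau>)\<close> is dominated by \<open>n log (1 + \<beta>(t))\<close> and
  vanishes as \<open>\<tau>\<close> grows, which gives the second.
\<close>

section \<open>Cross entropy, conditional distributions, and unions of balls\<close>

text \<open>This is \<open>ln x \<le> x - 1\<close> at \<open>x = q / p\<close>, multiplied by
  \<open>p\<close> and converted to bits. The corrections \<open>p / ln 2\<close> and
  \<open>q / ln 2\<close> stand on opposite sides, so that every summand is nonnegative and the
  inequality makes sense in \<open>ennreal\<close>, where subtraction truncates.\<close>

lemma gibbs_term:
  fixes p q :: real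
  assumes "0 \<le> p" "p \<le> 1" "0 < q" "q \<le> 1"
  shows "ennreal (- (p * log 2 p)) + ennreal (p / ln 2) \<le> ennreal p * ennreal (- log 2 q) + ennreal (q / ln 2)"
proof -
  have lq: "log 2 q \<le> 0" using assms by (simp add: log_def divide_nonpos_pos)
  have lp: "p * log 2 p \<le> 0"
    using assms by (cases "p = 0") (auto simp: log_def divide_nonpos_pos mult_nonneg_nonpos)
  have "p * ln q - p * ln p \<le> q - p"
  proof (cases "p = 0")
    case False
    hence p: "p > 0" using assms by simp
    have "ln (q / p) \<le> q / p - 1" using p assms by (intro ln_le_minus_one) auto
    hence "p * ln (q / p) \<le> p * (q / p - 1)" using p by (intro mult_left_mono) auto
    thus ?thesis using p assms by (simp add: ln_div algebra_simps)
  qed (use assms in auto)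
  hence "(p * ln q - p * ln p) / ln 2 \<le> (q - p) / ln 2" by (intro divide_right_mono) auto
  hence "- (p * log 2 p) + p / ln 2 \<le> p * (- log 2 q) + q / ln 2"
    by (simp add: log_def diff_divide_distrib algebra_simps)
  hence "ennreal (- (p * log 2 p) + p / ln 2) \<le> ennreal (p * (- log 2 q) + q / ln 2)"
    by (rule ennreal_leI)
  moreover have "ennreal p * ennreal (- log 2 q) = ennreal (p * (- log 2 q))"
    using assms lq by (intro ennreal_mult[symmetric]) auto
  moreover have "0 \<le> p * (- log 2 q)" using assms lq by (intro mult_nonneg_nonneg) auto
  ultimately show ?thesis
    using assms lp by (simp only: ennreal_plus[symmetric] neg_0_le_iff_le divide_nonneg_pos ln_gt_zero_iff less_imp_le)
qed

text \<open>Gibbs inequality: after summation over \<open>A\<close> the corrections total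
  \<open>1 / ln 2\<close> on the left and at most that on the right, hence cancel. Since
  \<open>q\<close> may be a sub-probability, an upper bound on the number of outcomes can stand in
  for the exact count. The right-hand side is an expectation over \<open>\<omega>\<close>, so it can
  be estimated outcome by outcome.\<close>

lemma shannon_entropy_distr_le:
  fixes Y :: "'a \<Rightarrow> 'b::polish_space" and q :: "'b \<Rightarrow> real"
  assumes M: "prob_space M" and Y[measurable]: "Y \<in> borel_measurable M"
    and A: "countable A" "AE \<omega> in M. Y \<omega> \<in> A"
    and q: "\<And>y. y \<in> A \<Longrightarrow> 0 < q y" "(\<integral>\<^sup>+ y. ennreal (q y) \<partial>count_space A) \<le> 1"
  shows "shannon_entropy (distr M borel Y) \<le> (\<integral>\<^sup>+ \<omega>. ennreal (- log 2 (q (Y \<omega>))) \<partial>M)"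
proof -
  interpret prob_space M by fact
  define D where "D = distr M borel Y"
  interpret D: prob_space D unfolding D_def by (rule prob_space_distr) simp
  have [measurable]: "A \<in> sets borel" using A(1) by (rule sets.countable[rotated]) simp
  have sD[simp]: "sets D = sets borel" "space D = UNIV" by (simp_all add: D_def)
  have DA: "AE y in D. y \<in> A"
    unfolding D_def using A(2) by (subst AE_distr_iff) auto
  define p where "p y = measure D {y}" for y
  have p01: "0 \<le> p y" "p y \<le> 1" for y by (simp_all add: p_def)
  have ep: "emeasure D {y} = ennreal (p y)" for y by (simp add: p_def D.emeasure_eq_measure)
  have p0: "p y = 0" if "y \<notin> A" for y
  proof -
    have "emeasure D {y} \<le> emeasure D (space D - A)" using that by (intro emeasure_mono) auto
    also have "\<dots> = 0" using DA by (subst (asm) AE_iff_measurable[OF _ refl]) (auto simp: Collect_neg_eq[symmetric] Compl_eq_Diff_UNIV[symmetric] Compl_eq)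
    finally show ?thesis using p01 by (simp add: ep)
  qed
  \<comment> \<open>A single mass is at most the total. Hence \<open>- log 2 (q y)\<close> is
    nonnegative on \<open>A\<close> and \<open>ennreal\<close> truncates nothing.\<close>
  have q1: "q y \<le> 1" if "y \<in> A" for y
  proof -
    have "ennreal (q y) = (\<integral>\<^sup>+ z. ennreal (q z) * indicator {y} z \<partial>count_space A)"
      using that by (subst nn_integral_indicator_singleton) auto
    also have "\<dots> \<le> (\<integral>\<^sup>+ z. ennreal (q z) \<partial>count_space A)"
      by (intro nn_integral_mono) (auto split: split_indicator)
    finally show ?thesis using q(2) by (metis ennreal_le_1 order_trans)
  qed
  have H: "shannon_entropy D = (\<integral>\<^sup>+ y. ennreal (- (p y * log 2 (p y))) \<partial>count_space A)"
  proof -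
    have "shannon_entropy D = (\<integral>\<^sup>+ y. ennreal (- (p y * log 2 (p y))) \<partial>count_space UNIV)"
      unfolding shannon_entropy_def p_def using A(1) DA by auto
    also have "\<dots> = (\<integral>\<^sup>+ y. ennreal (- (p y * log 2 (p y))) \<partial>count_space A)"
      by (rule nn_integral_count_space_eq) (auto simp: p0)
    finally show ?thesis .
  qed
  have sum1: "(\<integral>\<^sup>+ y. ennreal (p y) \<partial>count_space A) = 1"
  proof -
    have "(\<integral>\<^sup>+ y. ennreal (p y) \<partial>count_space A) = emeasure D A"
      using A(1) by (subst emeasure_countable_singleton) (auto simp: ep)
    also have "\<dots> = 1" using DA by (intro D.emeasure_eq_1_AE) auto
    finally show ?thesis .
  qed
  define c where "c = ennreal (1 / ln 2)"
  have c: "c \<noteq> \<top>" by (simp add: c_def)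
  have div: "ennreal (x / ln 2) = ennreal x * c" if "x \<ge> 0" for x
    using that by (simp add: c_def ennreal_mult[symmetric])
  have "shannon_entropy D + c = (\<integral>\<^sup>+ y. ennreal (- (p y * log 2 (p y))) + ennreal (p y / ln 2) \<partial>count_space A)"
    by (subst nn_integral_add) (auto simp: H div p01 nn_integral_multc sum1)
  also have "\<dots> \<le> (\<integral>\<^sup>+ y. ennreal (p y) * ennreal (- log 2 (q y)) + ennreal (q y / ln 2) \<partial>count_space A)"
    by (intro nn_integral_mono gibbs_term) (use p01 q q1 in auto)
  also have "\<dots> = (\<integral>\<^sup>+ y. ennreal (p y) * ennreal (- log 2 (q y)) + ennreal (q y) * c \<partial>count_space A)"
    using q(1) by (intro nn_integral_cong arg_cong2[where f="(+)"] refl div) (simp add: less_imp_le)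
  also have "\<dots> = (\<integral>\<^sup>+ y. ennreal (p y) * ennreal (- log 2 (q y)) \<partial>count_space A)
      + (\<integral>\<^sup>+ y. ennreal (q y) * c \<partial>count_space A)"
    by (rule nn_integral_add) simp_all
  also have "(\<integral>\<^sup>+ y. ennreal (q y) * c \<partial>count_space A) \<le> c"
    using mult_right_mono[OF q(2), of c] by (simp add: nn_integral_multc)
  finally have "shannon_entropy D \<le> (\<integral>\<^sup>+ y. ennreal (p y) * ennreal (- log 2 (q y)) \<partial>count_space A)"
    using c by (auto simp: ennreal_add_left_cancel_le add.commute[of _ c] dest!: order_trans[OF _ add_left_mono])
  \<comment> \<open>Each \<open>p y\<close> is the probability of \<open>Y = y\<close>. Exchanging
    the countable sum with the expectation leaves, for each \<open>\<omega>\<close>, only the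
    summand at \<open>y = Y \<omega>\<close>.\<close>
  also have "\<dots> = (\<integral>\<^sup>+ y. (\<integral>\<^sup>+ \<omega>. ennreal (- log 2 (q y)) * indicator (Y -` {y} \<inter> space M) \<omega> \<partial>M) \<partial>count_space A)"
    by (intro nn_integral_cong) (simp add: nn_integral_cmult_indicator ep[symmetric] D_def emeasure_distr mult.commute)
  also have "\<dots> = (\<integral>\<^sup>+ \<omega>. (\<integral>\<^sup>+ y. ennreal (- log 2 (q y)) * indicator (Y -` {y} \<inter> space M) \<omega> \<partial>count_space A) \<partial>M)"
    using A(1) by (subst nn_integral_count_space_nn_integral) auto
  also have "\<dots> \<le> (\<integral>\<^sup>+ \<omega>. ennreal (- log 2 (q (Y \<omega>))) \<partial>M)"
  proof (rule nn_integral_mono)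
    fix \<omega> assume "\<omega> \<in> space M"
    have "(\<integral>\<^sup>+ y. ennreal (- log 2 (q y)) * indicator (Y -` {y} \<inter> space M) \<omega> \<partial>count_space A)
        \<le> (\<integral>\<^sup>+ y. ennreal (- log 2 (q y)) * indicator {Y \<omega>} y \<partial>count_space UNIV)"
      by (subst nn_integral_count_space_indicator, simp, intro nn_integral_mono) (auto split: split_indicator)
    also have "\<dots> = ennreal (- log 2 (q (Y \<omega>)))"
      by (subst nn_integral_indicator_singleton) auto
    finally show "(\<integral>\<^sup>+ y. ennreal (- log 2 (q y)) * indicator (Y -` {y} \<inter> space M) \<omega> \<partial>count_space A) \<le> \<dots>" .
  qed
  finally show ?thesis unfolding D_def .
qed

text \<open>The small closed balls inside the union form a Vitali cover of it, so no measurability of the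
  set of centres is needed.\<close>

lemma sets_lebesgue_Union_cball:
  fixes A :: "'b::euclidean_space set"
  assumes "r > 0"
  shows "(\<Union>a\<in>A. cball a r) \<in> sets lebesgue"
proof -
  let ?S = "\<Union>a\<in>A. cball a r"
  define K where "K = {(c, d). d > 0 \<and> cball c d \<subseteq> ?S}"
  have cover: "\<exists>i. i \<in> K \<and> x \<in> cball (fst i) (snd i) \<and> snd i < d" if x: "x \<in> ?S" and d: "0 < d" for x d
  proof -
    obtain a where a: "a \<in> A" "x \<in> cball a r" using x by auto
    \<comment> \<open>Half of \<open>d\<close> makes the radius strictly smaller than
      \<open>d\<close>; the cap \<open>r\<close> lets the small ball fit into
      \<open>cball a r\<close>.\<close>
    define e where "e = min (d/2) r"
    have e: "0 < e" "e < d" "e \<le> r" using d assms by (auto simp: e_def)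
    \<comment> \<open>Moving from \<open>x\<close> towards \<open>a\<close> by the fraction
      \<open>e / r\<close> gives a centre within \<open>e\<close> of \<open>x\<close> and within
      \<open>r - e\<close> of \<open>a\<close>.\<close>
    define c where "c = x + (e / r) *\<^sub>R (a - x)"
    have "dist c x \<le> e"
    proof -
      have "norm (a - x) \<le> r" using a by (simp add: dist_norm)
      thus ?thesis using e assms by (simp add: c_def dist_norm mult.commute mult_imp_div_pos_le divide_le_eq mult_left_mono)
    qed
    moreover have "cball c e \<subseteq> cball a r"
    proof (rule subset_trans)
      have "a - c = (1 - e / r) *\<^sub>R (a - x)" by (simp add: c_def algebra_simps)
      hence "dist a c = (1 - e / r) * norm (a - x)" using e assms by (simp add: dist_norm)
      also have "\<dots> \<le> (1 - e / r) * r" using a e assms by (intro mult_left_mono) (auto simp: dist_norm)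
      also have "\<dots> = r - e" using assms by (simp add: algebra_simps)
      finally show "cball c e \<subseteq> cball a r" by (auto intro: order_trans[OF dist_triangle[of a _ c]] simp: add_mono)
           (metis add.commute diff_add_cancel add_mono dist_triangle_le order_trans dist_triangle)
    qed auto
    ultimately show ?thesis using a e
      by (intro exI[of _ "(c, e)"]) (auto simp: K_def dist_commute)
  qed
  have radius: "0 < snd i" if "i \<in> K" for i
    using that by (auto simp: K_def)
  obtain C where C: "countable C" "C \<subseteq> K" "negligible (?S - (\<Union>i\<in>C. cball (fst i) (snd i)))"
    by (rule Vitali_covering_theorem_cballs[of K snd ?S fst, OF radius cover])
  \<comment> \<open>A countable union of closed balls plus a negligible remainder; the remainder is
    Lebesgue measurable but possibly not Borel.\<close>
  have "?S = (\<Union>i\<in>C. cball (fst i) (snd i)) \<union> (?S - (\<Union>i\<in>C. cball (fst i) (snd i)))"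
    using C(2) by (fastforce simp: K_def)
  also have "\<dots> \<in> sets lebesgue"
    using C by (intro sets.Un sets.countable_UN') (auto simp: negligible_imp_sets)
  finally show ?thesis .
qed

section \<open>Regular conditional distributions: uniqueness, and the independent case\<close>

lemma AE_cond_distr_eq:
  fixes Y :: "'a \<Rightarrow> 'b::polish_space"
  assumes S: "S \<in> M \<rightarrow>\<^sub>M N" and M: "prob_space M"
    and K: "is_cond_distr M N Y S K" and K': "is_cond_distr M N Y S K'"
  shows "AE s in distr M N S. K s = K' s"
proof -
  interpret M: prob_space M by fact
  interpret D: prob_space "distr M N S" by (rule M.prob_space_distr[OF S])
  obtain \<B> :: "'b set set" where B: "countable \<B>" "topological_basis \<B>"
    using ex_countable_basis by auto
  \<comment> \<open>Closing a countable basis under finite intersections gives a countable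
    Int-stable generator. The empty family contributes \<open>UNIV\<close>, the finite-measure
    exhausting set for the uniqueness theorem below.\<close>
  define E where "E = {\<Inter>F |F. F \<subseteq> \<B> \<and> finite F}"
  have cE: "countable E"
  proof -
    have "E = Inter ` {F. F \<subseteq> \<B> \<and> finite F}" by (auto simp: E_def)
    thus ?thesis using countable_Collect_finite_subset[OF B(1)] by (simp add: conj_commute)
  qed
  have oE: "open X" if "X \<in> E" for X
    using that topological_basis_open[OF B(2)] by (auto simp: E_def intro!: open_Inter)
  have BE: "\<B> \<subseteq> E"
  proof
    fix b assume "b \<in> \<B>" thus "b \<in> E" unfolding E_def by (intro CollectI exI[of _ "{b}"]) auto
  qed
  have IntE: "Int_stable E"
  proof (rule Int_stableI)
    fix a b assume "a \<in> E" "b \<in> E"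
    then obtain F G where "a = \<Inter>F" "F \<subseteq> \<B>" "finite F" "b = \<Inter>G" "G \<subseteq> \<B>" "finite G" by (auto simp: E_def)
    thus "a \<inter> b \<in> E" unfolding E_def by (intro CollectI exI[of _ "F \<union> G"]) auto
  qed
  have gen: "sets (borel :: 'b measure) = sigma_sets UNIV E"
  proof (rule antisym)
    have "sets (borel :: 'b measure) = sigma_sets UNIV \<B>"
      unfolding borel_eq_countable_basis[OF B] by simp
    thus "sets (borel :: 'b measure) \<subseteq> sigma_sets UNIV E" using sigma_sets_mono'[OF BE] by auto
    show "sigma_sets UNIV E \<subseteq> sets (borel :: 'b measure)"
      using oE by (intro sets.sigma_sets_subset[of E borel, simplified]) auto
  qed
  have Km: "K \<in> N \<rightarrow>\<^sub>M prob_algebra borel" and K'm: "K' \<in> N \<rightarrow>\<^sub>M prob_algebra borel"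
    using K K' by (auto simp: is_cond_distr_def)
  have meas: "(\<lambda>s. emeasure (L s) X) \<in> borel_measurable (distr M N S)"
    if "L \<in> N \<rightarrow>\<^sub>M prob_algebra borel" "X \<in> E" for L :: "'c \<Rightarrow> 'b measure" and X
    using measurable_prob_algebraD[OF that(1)] oE[OF that(2)] by simp
  \<comment> \<open>For one fixed \<open>X\<close>, both kernels integrate to the same value over
    every \<open>A\<close>, so they are densities of the same measure. Countability of
    \<open>E\<close> then merges the exceptional null sets.\<close>
  have "AE s in distr M N S. emeasure (K s) X = emeasure (K' s) X" if X: "X \<in> E" for X
  proof (rule D.density_unique2)
    fix A assume "A \<in> sets (distr M N S)"
    then have AX: "A \<in> sets N" "X \<in> sets borel" using oE[OF X] by auto
    have "(\<integral>\<^sup>+ s\<in>A. emeasure (K s) X \<partial>distr M N S) = emeasure M {\<omega> \<in> space M. S \<omega> \<in> A \<and> Y \<omega> \<in> X}"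
      using K AX by (simp add: is_cond_distr_def)
    also have "\<dots> = (\<integral>\<^sup>+ s\<in>A. emeasure (K' s) X \<partial>distr M N S)"
      using K' AX by (simp add: is_cond_distr_def)
    finally show "(\<integral>\<^sup>+ s\<in>A. emeasure (K s) X \<partial>distr M N S) = (\<integral>\<^sup>+ s\<in>A. emeasure (K' s) X \<partial>distr M N S)" .
  qed (rule meas[OF Km X], rule meas[OF K'm X])
  hence "AE s in distr M N S. \<forall>X\<in>E. emeasure (K s) X = emeasure (K' s) X"
    unfolding AE_ball_countable[OF cE] by blast
  thus ?thesis
  proof (rule AE_mp, intro AE_I2 impI)
    fix s assume s: "s \<in> space (distr M N S)" and eq: "\<forall>X\<in>E. emeasure (K s) X = emeasure (K' s) X"
    have *: "sets (K s) = sets borel" "prob_space (K s)" "sets (K' s) = sets borel"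
      using measurable_space[OF Km, of s] measurable_space[OF K'm, of s] s by (auto simp: space_prob_algebra)
    have "UNIV \<in> E" unfolding E_def by (intro CollectI exI[of _ "{}"]) auto
    interpret prob_space "K s" by fact
    show "K s = K' s"
      by (rule measure_eqI_generator_eq[OF IntE, of UNIV _ _ "\<lambda>_. UNIV"])
         (use eq * gen \<open>UNIV \<in> E\<close> in auto)
  qed
qed

text \<open>Any explicit version may replace the chosen one: the existence of \<open>K\<close> makes
  the choice a genuine version, and two versions differ only on a null set of conditions.\<close>

lemma cond_entropy_eq:
  fixes Y :: "'a \<Rightarrow> 'b::polish_space"
  assumes "S \<in> M \<rightarrow>\<^sub>M N" "prob_space M" "is_cond_distr M N Y S K"
  shows "cond_entropy M N Y S = (\<integral>\<^sup>+ s. shannon_entropy (K s) \<partial>distr M N S)"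
  unfolding cond_entropy_def
proof (rule nn_integral_cong_AE)
  have "is_cond_distr M N Y S (SOME K. is_cond_distr M N Y S K)"
    by (rule someI[of "is_cond_distr M N Y S", OF assms(3)])
  from AE_cond_distr_eq[OF assms(1,2) this assms(3)]
  show "AE s in distr M N S. shannon_entropy ((SOME K. is_cond_distr M N Y S K) s) = shannon_entropy (K s)"
    by eventually_elim simp
qed

lemma distr_pair_eq_pair_measure:
  assumes M: "prob_space M" and ind: "indep_rvs M N1 X N2 S"
  shows "distr M (N1 \<Otimes>\<^sub>M N2) (\<lambda>\<omega>. (X \<omega>, S \<omega>)) = distr M N1 X \<Otimes>\<^sub>M distr M N2 S"
proof -
  interpret prob_space M by fact
  have [measurable]: "X \<in> M \<rightarrow>\<^sub>M N1" "S \<in> M \<rightarrow>\<^sub>M N2"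
    and set: "indep_set {X -` A \<inter> space M | A. A \<in> sets N1} {S -` A \<inter> space M | A. A \<in> sets N2}"
    using ind by (auto simp: indep_rvs_def)
  interpret X: prob_space "distr M N1 X" by (rule prob_space_distr) simp
  interpret S: prob_space "distr M N2 S" by (rule prob_space_distr) simp
  show ?thesis
  proof (rule pair_measure_eqI[symmetric])
    fix A B assume "A \<in> sets (distr M N1 X)" "B \<in> sets (distr M N2 S)"
    hence [measurable]: "A \<in> sets N1" "B \<in> sets N2" by auto
    have "prob ((X -` A \<inter> space M) \<inter> (S -` B \<inter> space M)) = prob (X -` A \<inter> space M) * prob (S -` B \<inter> space M)"
      by (rule indep_setD[OF set]) auto
    also have "(X -` A \<inter> space M) \<inter> (S -` B \<inter> space M) = (\<lambda>\<omega>. (X \<omega>, S \<omega>)) -` (A \<times> B) \<inter> space M"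
      by auto
    finally show "emeasure (distr M N1 X) A * emeasure (distr M N2 S) B
        = emeasure (distr M (N1 \<Otimes>\<^sub>M N2) (\<lambda>\<omega>. (X \<omega>, S \<omega>))) (A \<times> B)"
      by (simp add: emeasure_distr emeasure_eq_measure ennreal_mult)
  qed (auto intro: X.sigma_finite_measure_axioms S.sigma_finite_measure_axioms)
qed

text \<open>Under independence, conditioning on \<open>S = s\<close> leaves the law of
  \<open>X\<close> unchanged, so the conditional law of the output is the image of that law under
  \<open>L\<close> with its second argument frozen at \<open>s\<close>. The defining identity is
  Fubini for the product law.\<close>

lemma is_cond_distr_indep:
  fixes L :: "'x \<Rightarrow> 's \<Rightarrow> 'b::polish_space"
  assumes M: "prob_space M" and ind: "indep_rvs M N1 X N2 S"
    and L[measurable]: "(\<lambda>(x, s). L x s) \<in> borel_measurable (N1 \<Otimes>\<^sub>M N2)"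
  shows "is_cond_distr M N2 (\<lambda>\<omega>. L (X \<omega>) (S \<omega>)) S (\<lambda>s. distr M borel (\<lambda>\<omega>. L (X \<omega>) s))"
  unfolding is_cond_distr_def
proof safe
  interpret prob_space M by fact
  have [measurable]: "X \<in> M \<rightarrow>\<^sub>M N1" "S \<in> M \<rightarrow>\<^sub>M N2"
    using ind by (auto simp: indep_rvs_def)
  have Ls[measurable]: "(\<lambda>x. L x s) \<in> borel_measurable N1" if "s \<in> space N2" for s
    using measurable_compose[OF measurable_Pair2'[OF that] L] by simp
  show "(\<lambda>s. distr M borel (\<lambda>\<omega>. L (X \<omega>) s)) \<in> N2 \<rightarrow>\<^sub>M prob_algebra borel"
  proof (rule measurable_distr_prob_space2[where M = M])
    show "(\<lambda>s. M) \<in> N2 \<rightarrow>\<^sub>M prob_algebra M"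
      by (rule measurable_const) (simp add: space_prob_algebra prob_space_axioms)
    show "(\<lambda>(s, \<omega>). L (X \<omega>) s) \<in> borel_measurable (N2 \<Otimes>\<^sub>M M)"
      using measurable_compose[of "\<lambda>p. (X (snd p), fst p)" "N2 \<Otimes>\<^sub>M M" "N1 \<Otimes>\<^sub>M N2", OF _ L]
      by (simp add: split_beta)
  qed
  fix A and B :: "'b set" assume A[measurable]: "A \<in> sets N2" and B[measurable]: "B \<in> sets borel"
  interpret X: prob_space "distr M N1 X" by (rule prob_space_distr) simp
  interpret S: prob_space "distr M N2 S" by (rule prob_space_distr) simp
  interpret XS: pair_sigma_finite "distr M N1 X" "distr M N2 S" ..
  have [measurable]: "(\<lambda>z. L (fst z) (snd z)) \<in> borel_measurable (N1 \<Otimes>\<^sub>M N2)"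
    using L by (simp add: split_beta)
  define Z where "Z = {z \<in> space (N1 \<Otimes>\<^sub>M N2). snd z \<in> A \<and> L (fst z) (snd z) \<in> B}"
  have Z[measurable]: "Z \<in> sets (N1 \<Otimes>\<^sub>M N2)" unfolding Z_def by measurable
  have "emeasure M {\<omega> \<in> space M. S \<omega> \<in> A \<and> L (X \<omega>) (S \<omega>) \<in> B}
      = emeasure (distr M (N1 \<Otimes>\<^sub>M N2) (\<lambda>\<omega>. (X \<omega>, S \<omega>))) Z"
    by (subst emeasure_distr) (auto intro!: arg_cong[where f="emeasure M"] simp: Z_def space_pair_measure
        dest: measurable_space[OF \<open>X \<in> M \<rightarrow>\<^sub>M N1\<close>] measurable_space[OF \<open>S \<in> M \<rightarrow>\<^sub>M N2\<close>])
  also have "\<dots> = emeasure (distr M N1 X \<Otimes>\<^sub>M distr M N2 S) Z"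
    by (simp add: distr_pair_eq_pair_measure[OF M ind])
  also have "\<dots> = (\<integral>\<^sup>+ s. emeasure (distr M N1 X) ((\<lambda>x. (x, s)) -` Z) \<partial>distr M N2 S)"
    by (rule XS.emeasure_pair_measure_alt2) (simp cong: sets_pair_measure_cong)
  also have "\<dots> = (\<integral>\<^sup>+ s\<in>A. emeasure (distr M borel (\<lambda>\<omega>. L (X \<omega>) s)) B \<partial>distr M N2 S)"
  proof (rule nn_integral_cong)
    fix s assume "s \<in> space (distr M N2 S)"
    hence s: "s \<in> space N2" by simp
    note [measurable] = Ls[OF s]
    have "(\<lambda>x. (x, s)) -` Z = (if s \<in> A then {x \<in> space N1. L x s \<in> B} else {})"
      using s by (auto simp: Z_def space_pair_measure)
    thus "emeasure (distr M N1 X) ((\<lambda>x. (x, s)) -` Z)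
        = emeasure (distr M borel (\<lambda>\<omega>. L (X \<omega>) s)) B * indicator A s"
      by (auto simp: emeasure_distr split: split_indicator intro!: arg_cong[where f="emeasure M"]
           dest: measurable_space[OF \<open>X \<in> M \<rightarrow>\<^sub>M N1\<close>])
  qed
  finally show "emeasure M {\<omega> \<in> space M. S \<omega> \<in> A \<and> L (X \<omega>) (S \<omega>) \<in> B}
     = (\<integral>\<^sup>+ s\<in>A. emeasure (distr M borel (\<lambda>\<omega>. L (X \<omega>) s)) B \<partial>distr M N2 S)" .
qed

section \<open>Basic cells and rejection sampling\<close>

lemma emeasure_lborel_translate:
  fixes A :: "'b::euclidean_space set"
  assumes "A \<in> sets borel"
  shows "emeasure lborel {z. z + c \<in> A} = emeasure lborel A"
proof -
  have "emeasure lborel A = emeasure (distr lborel borel ((+) c)) A"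
    by (simp add: lborel_distr_plus)
  also have "\<dots> = emeasure lborel {z. z + c \<in> A}"
    using assms by (subst emeasure_distr) (auto simp: vimage_def add.commute)
  finally show ?thesis by simp
qed

text \<open>Tail-sum formula: \<open>Suc (k v)\<close> counts the \<open>j \<le> k v\<close>, and
  for each of these the first \<open>j\<close> draws all lie in \<open>R\<close>. That event has
  probability at most \<open>(1 - a) ^ j\<close>, and the geometric series sums to
  \<open>1 / a\<close>.\<close>

lemma nn_integral_stopping_time_le:
  fixes D :: "'v measure" and k :: "(nat \<Rightarrow> 'v) \<Rightarrow> nat"
  assumes D: "prob_space D" and R: "R \<in> sets D" "emeasure D R \<le> ennreal (1 - a)"
    and a: "0 < a" "a \<le> 1"
    and k: "\<And>v j i. j \<le> k v \<Longrightarrow> i < j \<Longrightarrow> v \<in> space (\<Pi>\<^sub>M i\<in>UNIV. D) \<Longrightarrow> v i \<in> R"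
  shows "(\<integral>\<^sup>+ v. ennreal (real (Suc (k v))) \<partial>(\<Pi>\<^sub>M i\<in>UNIV. D)) \<le> ennreal (1 / a)"
proof -
  let ?\<Pi> = "\<Pi>\<^sub>M i\<in>(UNIV::nat set). D"
  define B where "B j = prod_emb UNIV (\<lambda>_. D) {..<j} (\<Pi>\<^sub>E i\<in>{..<j}. R)" for j :: nat
  have B[measurable]: "B j \<in> sets ?\<Pi>" for j
    unfolding B_def using R by (intro sets_PiM_I) auto
  have eB: "emeasure ?\<Pi> (B j) \<le> ennreal ((1 - a) ^ j)" for j
  proof -
    have "emeasure ?\<Pi> (B j) = emeasure D R ^ j"
      unfolding B_def using R D by (subst emeasure_PiM_emb) auto
    also have "\<dots> \<le> ennreal (1 - a) ^ j" by (intro power_mono R) simp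
    also have "\<dots> = ennreal ((1 - a) ^ j)" using a by (intro ennreal_power) simp
    finally show ?thesis .
  qed
  have "(\<integral>\<^sup>+ v. ennreal (real (Suc (k v))) \<partial>?\<Pi>) \<le> (\<integral>\<^sup>+ v. (\<Sum>j. indicator (B j) v) \<partial>?\<Pi>)"
  proof (rule nn_integral_mono)
    fix v assume v: "v \<in> space ?\<Pi>"
    have in_B: "v \<in> B j" if "j \<le> k v" for j
      using v k[OF that _ v] unfolding B_def prod_emb_def by (auto simp: space_PiM)
    have "ennreal (real (Suc (k v))) = (\<Sum>j<Suc (k v). 1)"
      by (simp only: sum_constant card_lessThan) (simp add: ennreal_of_nat_eq_real_of_nat)
    also have "\<dots> = (\<Sum>j<Suc (k v). indicator (B j) v)"
      using in_B by (intro sum.cong) auto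
    also have "\<dots> \<le> (\<Sum>j. indicator (B j) v)" by (rule sum_le_suminf) auto
    finally show "ennreal (real (Suc (k v))) \<le> (\<Sum>j. indicator (B j) v)" .
  qed
  also have "\<dots> = (\<Sum>j. emeasure ?\<Pi> (B j))"
    by (subst nn_integral_suminf) auto
  also have "\<dots> \<le> (\<Sum>j. ennreal ((1 - a) ^ j))" by (intro suminf_le eB) auto
  also have "\<dots> = ennreal (\<Sum>j. (1 - a) ^ j)"
    using a by (intro suminf_ennreal_eq summable_sums summable_geometric) auto
  also have "(\<Sum>j. (1 - a) ^ j) = 1 / a" using a by (subst suminf_geometric) auto
  finally show ?thesis .
qed

lemma lattice_point_uminus: "lattice_point G (- j) = - lattice_point G j"
  unfolding lattice_point_def by (simp add: vec_eq_iff matrix_vector_mult_def sum_negf)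

section \<open>Lattice cells: partition, quantizer, and packing\<close>

locale lattice_cell =
  fixes G :: "real^'n^'n" and P :: "(real^'n) set"
  assumes cell: "basic_cell G P" and P_borel[measurable]: "P \<in> sets borel"
begin

definition \<Lambda> :: "(real^'n) set" where "\<Lambda> = range (lattice_point G)"

lemma countable_\<Lambda>: "countable \<Lambda>" by (simp add: \<Lambda>_def)

lemma uminus_\<Lambda>: "y \<in> \<Lambda> \<Longrightarrow> - y \<in> \<Lambda>"
  by (auto simp: \<Lambda>_def lattice_point_uminus[symmetric])

lemma mem_translate: "z \<in> P + {c} \<longleftrightarrow> z - c \<in> P"
  by (auto simp: set_plus_def algebra_simps intro: bexI[of _ "z - c"])

lemma ex_lattice: "\<exists>y\<in>\<Lambda>. z - y \<in> P"
proof -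
  have "z \<in> (\<Union>j. P + {lattice_point G j})" using cell by (simp add: basic_cell_def)
  thus ?thesis by (auto simp: mem_translate \<Lambda>_def)
qed

lemma lattice_unique: "\<lbrakk>y \<in> \<Lambda>; y' \<in> \<Lambda>; z - y \<in> P; z - y' \<in> P\<rbrakk> \<Longrightarrow> y = y'"
  using cell unfolding basic_cell_def disjoint_family_on_def \<Lambda>_def
  by (auto simp: set_eq_iff mem_translate) metis

lemma bounded_P: "bounded P" using cell by (simp add: basic_cell_def)

lemma emeasure_P_finite: "emeasure lborel P < \<infinity>"
  using emeasure_bounded_finite[OF bounded_P] by (simp add: top.not_eq_extremum)

text \<open>Countably many translates of a null cell could not cover the whole space.\<close>

lemma emeasure_P_pos: "0 < emeasure lborel P"
proof (rule ccontr)
  assume "\<not> 0 < emeasure lborel P"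
  hence 0: "emeasure lborel P = 0" by (simp add: zero_less_iff_neq_zero)
  have [measurable]: "{z. z + - y \<in> P} \<in> sets borel" for y by measurable
  have "emeasure lborel {z. z + - y \<in> P} = 0" for y
    using emeasure_lborel_translate[OF P_borel, of "- y"] 0 by simp
  hence "(\<Union>y\<in>\<Lambda>. {z. z + - y \<in> P}) \<in> null_sets lborel"
    using countable_\<Lambda> by (intro null_sets_UN') auto
  moreover have "(\<Union>y\<in>\<Lambda>. {z. z + - y \<in> P}) = UNIV" using ex_lattice by auto
  ultimately show False by (simp add: null_sets_def)
qed

definition vol :: real where "vol = measure lborel P"

lemma emeasure_P: "emeasure lborel P = ennreal vol"
  unfolding vol_def using emeasure_P_finite by (intro emeasure_eq_ennreal_measure) auto

lemma vol_pos: "0 < vol"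
  using emeasure_P_pos by (simp add: emeasure_P)

text \<open>Membership of \<open>x\<close> in the reflected cell at \<open>y\<close> means
  \<open>y - x \<in> P\<close>. The partition property is stated for \<open>P\<close> itself, so
  uniqueness is obtained from the negated points \<open>- y\<close>, \<open>- y'\<close> and
  \<open>- x\<close>.\<close>

lemma quantizer_eq:
  assumes "y \<in> \<Lambda>" "y - x \<in> P"
  shows "cell_quantizer G P x = y"
proof -
  have *: "x \<in> uminus ` P + {y} \<longleftrightarrow> y - x \<in> P" for y
  proof
    assume "x \<in> uminus ` P + {y}" thus "y - x \<in> P" by (auto simp: set_plus_def)
  next
    assume "y - x \<in> P" thus "x \<in> uminus ` P + {y}"
      unfolding set_plus_def by (intro CollectI bexI[of _ "- (y - x)"] bexI[of _ y] imageI) auto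
  qed
  have uniq: "y' = y" if "y' \<in> \<Lambda>" "y' - x \<in> P" for y'
    using lattice_unique[of "- y'" "- y" "- x"] that assms uminus_\<Lambda> by simp
  show ?thesis
    unfolding cell_quantizer_def *
  proof (rule the_equality)
    show "y \<in> range (lattice_point G) \<and> y - x \<in> P" using assms by (simp add: \<Lambda>_def)
    show "\<And>y'. y' \<in> range (lattice_point G) \<and> y' - x \<in> P \<Longrightarrow> y' = y"
      using uniq by (simp add: \<Lambda>_def)
  qed
qed

lemma ex_quantizer: "\<exists>y\<in>\<Lambda>. y - x \<in> P"
proof -
  obtain y where "y \<in> \<Lambda>" "- x - y \<in> P" using ex_lattice by blast
  thus ?thesis using uminus_\<Lambda> by (metis minus_diff_commute)
qed

lemma quantizer_mem: "cell_quantizer G P x \<in> \<Lambda>" "cell_quantizer G P x - x \<in> P"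
  using ex_quantizer[of x] quantizer_eq[of _ x] by auto

lemma measurable_quantizer[measurable]: "cell_quantizer G P \<in> borel_measurable borel"
proof (rule measurableI)
  fix B :: "(real^'n) set" assume "B \<in> sets borel"
  have "cell_quantizer G P -` B \<inter> space borel = (\<Union>y\<in>\<Lambda> \<inter> B. {x. y - x \<in> P})"
    using quantizer_mem quantizer_eq by auto
  also have "\<dots> \<in> sets borel"
    using countable_\<Lambda> by (intro sets.countable_UN') auto
  finally show "cell_quantizer G P -` B \<inter> space borel \<in> sets borel" .
qed simp

text \<open>On \<open>P\<close> the map from the dither \<open>v\<close> to the quantization error
  is piecewise a translation, and its pieces rearrange \<open>P\<close> modulo the lattice. It
  therefore preserves measure: the error of a uniformly dithered quantizer is uniform on
  \<open>P\<close>.\<close>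

lemma emeasure_fold:
  assumes E[measurable]: "E \<in> sets borel" and "E \<subseteq> P"
  shows "emeasure lborel {v \<in> P. cell_quantizer G P (x - v) + v - x \<in> E} = emeasure lborel E"
proof -
  \<comment> \<open>As \<open>E\<close> lies in \<open>P\<close>, landing in \<open>E\<close> after
    the shift by \<open>y - x\<close> already forces the quantizer to output \<open>y\<close>; hence
    the pieces indexed by \<open>y\<close> are disjoint.\<close>
  have *: "cell_quantizer G P (x - v) = y" if "y \<in> \<Lambda>" "v + (y - x) \<in> E" for v y
    using that \<open>E \<subseteq> P\<close> by (intro quantizer_eq) (auto simp: algebra_simps)
  have "{v \<in> P. cell_quantizer G P (x - v) + v - x \<in> E} = (\<Union>y\<in>\<Lambda>. {v \<in> P. v + (y - x) \<in> E})"
    using * quantizer_mem(1)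
    by (auto simp: algebra_simps) (metis add.commute add_diff_eq)+
  also have "emeasure lborel \<dots> = (\<integral>\<^sup>+ y. emeasure lborel {v \<in> P. v + (y - x) \<in> E} \<partial>count_space \<Lambda>)"
    using countable_\<Lambda> * by (intro emeasure_UN_countable) (auto simp: disjoint_family_on_def)
  also have "\<dots> = (\<integral>\<^sup>+ y. emeasure lborel {e \<in> E. e - (y - x) \<in> P} \<partial>count_space \<Lambda>)"
    by (intro nn_integral_cong, subst emeasure_lborel_translate[symmetric])
       (auto intro!: arg_cong[where f="emeasure lborel"])
  \<comment> \<open>After translation the pieces are disjoint again, because \<open>y\<close> is the
    unique lattice point whose cell contains \<open>e + x\<close>.\<close>
  also have "\<dots> = emeasure lborel (\<Union>y\<in>\<Lambda>. {e \<in> E. e - (y - x) \<in> P})"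
    using countable_\<Lambda> lattice_unique[of _ _ "_ + x"]
    by (intro emeasure_UN_countable[symmetric]) (auto simp: disjoint_family_on_def algebra_simps)
  also have "(\<Union>y\<in>\<Lambda>. {e \<in> E. e - (y - x) \<in> P}) = E"
    using ex_lattice[of "_ + x"] by (auto simp: algebra_simps)
  finally show ?thesis .
qed

text \<open>Packing argument: the points of \<open>C\<close> lie on one shifted and scaled lattice,
  so the copies of \<open>b P\<close> attached to them are disjoint. Their common volume times their
  number is at most the volume of a region containing all of them. Using \<open>count_space\<close>
  allows an infinite \<open>C\<close> until the bound is known.\<close>

lemma emeasure_packing:
  assumes b: "b > 0" and P: "\<And>p. p \<in> P \<Longrightarrow> norm p \<le> r" and r: "r > 0"
    and C: "C \<subseteq> {y. (\<exists>l\<in>\<Lambda>. y = b *\<^sub>R (l + v)) \<and> (\<exists>x\<in>X. \<exists>p\<in>P. y = x + b *\<^sub>R p)}"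
  shows "emeasure (count_space UNIV) C * ennreal (b ^ CARD('n) * vol)
    \<le> emeasure lebesgue (\<Union>x\<in>X. cball x (3 * r * b))"
proof -
  let ?T = "\<lambda>y. (\<lambda>p. b *\<^sub>R p + y) ` P"
  have "C \<subseteq> (\<lambda>l. b *\<^sub>R (l + v)) ` \<Lambda>" using C by auto
  hence cC: "countable C" using countable_\<Lambda> by (meson countable_image countable_subset)
  have [measurable]: "?T y \<in> sets borel" for y
  proof -
    have "?T y = {z. (z - y) /\<^sub>R b \<in> P}"
      using b by (auto simp: image_iff intro!: bexI[of _ "(_ - y) /\<^sub>R b"])
    thus ?thesis by simp
  qed
  have eT: "emeasure lebesgue (?T y) = ennreal (b ^ CARD('n) * vol)" for y
    using emeasure_lebesgue_affine[of b y P] b vol_pos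
    by (simp add: emeasure_P ennreal_mult ennreal_power[symmetric])
  have disj: "y = y'" if y: "y \<in> C" "y' \<in> C" "z \<in> ?T y" "z \<in> ?T y'" for y y' z
  proof -
    obtain l l' p p' where *: "l \<in> \<Lambda>" "y = b *\<^sub>R (l + v)" "l' \<in> \<Lambda>" "y' = b *\<^sub>R (l' + v)"
      "p \<in> P" "p' \<in> P" "z = b *\<^sub>R p + y" "z = b *\<^sub>R p' + y'" using y C by blast
    hence "b *\<^sub>R (p + l + v) = b *\<^sub>R (p' + l' + v)" by (simp add: algebra_simps)
    hence "p + l = p' + l'" using b by simp
    hence "p + l - l' = p'" by simp
    hence "l = l'" using *(1,3,5,6) by (intro lattice_unique[of l l' "p + l"]) auto
    thus ?thesis using * by simp
  qed
  have "emeasure (count_space UNIV) C * ennreal (b ^ CARD('n) * vol)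
      = (\<integral>\<^sup>+ y. emeasure lebesgue (?T y) \<partial>count_space C)"
    by (simp add: eT mult.commute emeasure_count_space)
  also have "\<dots> = emeasure lebesgue (\<Union>y\<in>C. ?T y)"
    using cC disj by (intro emeasure_UN_countable[symmetric]) (auto simp: disjoint_family_on_def)
  also have "\<dots> \<le> emeasure lebesgue (\<Union>x\<in>X. cball x (3 * r * b))"
  proof (rule emeasure_mono)
    show "(\<Union>y\<in>C. ?T y) \<subseteq> (\<Union>x\<in>X. cball x (3 * r * b))"
    proof safe
      fix y p assume "y \<in> C" "p \<in> P"
      then obtain x p' where x: "x \<in> X" "p' \<in> P" "y = x + b *\<^sub>R p'" using C by blast
      \<comment> \<open>One displacement leads from the input to the output point, the other runs
        within the cell attached to it; each has length at most \<open>b * r\<close>.\<close>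
      have "norm (b *\<^sub>R p + b *\<^sub>R p') \<le> b * r + b * r"
        using b P[OF \<open>p \<in> P\<close>] P[OF \<open>p' \<in> P\<close>]
        by (intro order_trans[OF norm_triangle_ineq] add_mono) (auto intro: mult_left_mono)
      also have "\<dots> \<le> 3 * r * b" using b r by simp
      finally have "dist x (b *\<^sub>R p + y) \<le> 3 * r * b"
        by (simp add: x dist_norm norm_minus_commute algebra_simps)
      thus "b *\<^sub>R p + y \<in> (\<Union>x\<in>X. cball x (3 * r * b))" using x by auto
    qed
    show "(\<Union>x\<in>X. cball x (3 * r * b)) \<in> sets lebesgue"
      using r b by (intro sets_lebesgue_Union_cball) simp
  qed
  finally show ?thesis .
qed

lemma sets_lrsuq_state: "sets (lrsuq_state P f) = sets (borel \<Otimes>\<^sub>M (\<Pi>\<^sub>M i\<in>UNIV. borel))"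
  unfolding lrsuq_state_def layer_distr_def
  by (intro sets_pair_measure_cong sets_PiM_cong) auto

lemma measurable_lrsuq:
  fixes f :: "real^'n \<Rightarrow> real"
  assumes [measurable]: "f \<in> borel_measurable borel" "\<beta> \<in> borel_measurable borel"
  shows "(\<lambda>(x, s). lrsuq G P f \<beta> x s) \<in> borel_measurable (borel \<Otimes>\<^sub>M lrsuq_state P f)"
proof -
  let ?N = "borel \<Otimes>\<^sub>M (borel \<Otimes>\<^sub>M (\<Pi>\<^sub>M i\<in>UNIV. borel)) :: ((real^'n) \<times> real \<times> (nat \<Rightarrow> real^'n)) measure"
  define y where "y i z = \<beta> (fst (snd z)) *\<^sub>R
     (cell_quantizer G P (fst z /\<^sub>R \<beta> (fst (snd z)) - snd (snd z) i) + snd (snd z) i)"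
    for i and z :: "(real^'n) \<times> real \<times> (nat \<Rightarrow> real^'n)"
  have [measurable]: "y i \<in> borel_measurable ?N" for i
    unfolding y_def by measurable
  define k where "k z = (LEAST i. f (y i z - fst z) \<ge> fst (snd z))" for z
  have [measurable]: "k \<in> ?N \<rightarrow>\<^sub>M count_space UNIV" unfolding k_def by measurable
  \<comment> \<open>The random index takes countably many values, so measurability for every frozen
    index is enough.\<close>
  have "(\<lambda>z. y (k z) z) \<in> borel_measurable ?N"
    by (rule measurable_compose_countable) measurable
  also have "(\<lambda>z. y (k z) z) = (\<lambda>(x, s). lrsuq G P f \<beta> x s)"
    by (auto simp: fun_eq_iff lrsuq_def Let_def y_def k_def superlevel_def)
  also have "borel_measurable ?N = borel_measurable (borel \<Otimes>\<^sub>M lrsuq_state P f)"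
    by (intro measurable_cong_sets sets_pair_measure_cong) (simp_all add: sets_lrsuq_state)
  finally show ?thesis .
qed

end

section \<open>The quantizer given its state\<close>

lemma borel_measurable_mono_ennreal:
  fixes V :: "real \<Rightarrow> ennreal"
  assumes "mono V"
  shows "V \<in> borel_measurable borel"
proof (rule borel_measurableI_greater)
  fix y
  \<comment> \<open>The indicator of a strict upper level set of a monotone function is itself
    monotone, and it is real-valued.\<close>
  have "(\<lambda>r. of_bool (y < V r) :: real) \<in> borel_measurable borel"
    using assms by (intro borel_measurable_mono) (auto simp: mono_def intro: less_le_trans)
  hence "(\<lambda>r. of_bool (y < V r) :: real) -` {1} \<inter> space borel \<in> sets borel"
    by (rule measurable_sets) simp
  also have "(\<lambda>r. of_bool (y < V r) :: real) -` {1} \<inter> space borel = {x \<in> space borel. y < V x}"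
    by auto
  finally show "{x \<in> space borel. y < V x} \<in> sets borel" .
qed

lemma measurable_emeasure_superlevel:
  fixes f :: "'b::euclidean_space \<Rightarrow> real"
  assumes [measurable]: "f \<in> borel_measurable borel"
  shows "(\<lambda>t. emeasure lborel (superlevel f t)) \<in> borel_measurable borel"
  unfolding superlevel_def by measurable

text \<open>Layer-cake formula: by Fubini the region under the graph of \<open>f\<close> is
  integrated in \<open>t\<close> first, where each \<open>z\<close> contributes the length
  \<open>f z\<close>.\<close>

lemma prob_space_layer_distr:
  fixes f :: "'b::euclidean_space \<Rightarrow> real"
  assumes f: "is_pdf f"
  shows "prob_space (layer_distr f)"
proof
  have [measurable]: "f \<in> borel_measurable borel" and f0: "0 \<le> f z" for z
    using f by (auto simp: is_pdf_def)
  note measurable_emeasure_superlevel[of f, measurable]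
  have "emeasure (layer_distr f) (space (layer_distr f))
      = (\<integral>\<^sup>+ t. indicator {0<..} t * emeasure lborel (superlevel f t) \<partial>lborel)"
    unfolding layer_distr_def by (subst emeasure_density) auto
  also have "\<dots> = (\<integral>\<^sup>+ t. (\<integral>\<^sup>+ z. indicator {0<..f z} t \<partial>lborel) \<partial>lborel)"
  proof (rule nn_integral_cong)
    fix t :: real
    have "(\<integral>\<^sup>+ z. indicator {0<..f z} t \<partial>lborel) = (\<integral>\<^sup>+ z. indicator {0<..} t * indicator (superlevel f t) z \<partial>lborel)"
      by (intro nn_integral_cong) (auto simp: superlevel_def split: split_indicator)
    also have "\<dots> = indicator {0<..} t * emeasure lborel (superlevel f t)"
      by (subst nn_integral_cmult_indicator) (auto simp: superlevel_def)
    finally show "indicator {0<..} t * emeasure lborel (superlevel f t) = (\<integral>\<^sup>+ z. indicator {0<..f z} t \<partial>lborel)" ..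
  qed
  also have "\<dots> = (\<integral>\<^sup>+ z. (\<integral>\<^sup>+ t. indicator {0<..f z} t \<partial>lborel) \<partial>lborel)"
  proof -
    have "(\<lambda>(t, z). indicator {0<..f z} t :: ennreal) \<in> borel_measurable (lborel \<Otimes>\<^sub>M lborel)"
      unfolding split_beta indicator_def greaterThanAtMost_iff by measurable
    thus ?thesis by (rule lborel_pair.Fubini'[symmetric])
  qed
  also have "\<dots> = (\<integral>\<^sup>+ z. ennreal (f z) \<partial>lborel)"
    using f0 by (intro nn_integral_cong) simp
  also have "\<dots> = 1" using f by (simp add: is_pdf_def)
  finally show "emeasure (layer_distr f) (space (layer_distr f)) = 1" .
qed

section \<open>Layers and the acceptance probability\<close>

locale layered_quantizer = lattice_cell G P for G :: "real^'n^'n" and P +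
  fixes f :: "real^'n \<Rightarrow> real" and \<beta> :: "real \<Rightarrow> real" and \<eta> :: real
  assumes pdf: "is_pdf f"
    and bounded_superlevel: "\<And>t. t > 0 \<Longrightarrow> bounded (superlevel f t)"
    and \<beta>_borel[measurable]: "\<beta> \<in> borel_measurable borel"
    and \<beta>_nonneg: "\<And>t. t > 0 \<Longrightarrow> \<beta> t \<ge> 0"
    and cover: "\<And>t. t > 0 \<Longrightarrow> superlevel f t \<subseteq> (\<lambda>p. \<beta> t *\<^sub>R p) ` P"
    and \<eta>: "\<eta> = (SUP x\<in>P. norm x)"
begin

lemma f_borel[measurable]: "f \<in> borel_measurable borel"
  using pdf by (simp add: is_pdf_def)

lemma superlevel_borel[measurable]: "superlevel f t \<in> sets borel"
  unfolding superlevel_def by measurable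

definition m :: "real \<Rightarrow> real" where "m t = measure lborel (superlevel f t)"

lemma emeasure_superlevel: "t > 0 \<Longrightarrow> emeasure lborel (superlevel f t) = ennreal (m t)"
  unfolding m_def using emeasure_bounded_finite[OF bounded_superlevel, of t]
  by (intro emeasure_eq_ennreal_measure) auto

lemma m_borel[measurable]: "m \<in> borel_measurable borel"
  using measurable_emeasure_superlevel[of f] unfolding m_def measure_def by simp

lemma norm_le_\<eta>: "p \<in> P \<Longrightarrow> norm p \<le> \<eta>"
  unfolding \<eta> using bounded_P by (intro cSUP_upper) (auto simp: bounded_iff bdd_above_def)

lemma \<eta>_pos: "0 < \<eta>"
proof (rule ccontr)
  assume "\<not> 0 < \<eta>"
  hence "p = 0" if "p \<in> P" for p
    using order_trans[OF norm_le_\<eta>[OF that], of 0] by simp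
  hence "P \<subseteq> {0}" by auto
  hence "emeasure lborel P \<le> emeasure lborel {0 :: real^'n}" by (intro emeasure_mono) auto
  thus False using emeasure_P_pos by simp
qed

text \<open>Almost every layer under \<open>layer_distr f\<close> is of this kind. Elsewhere
  \<open>\<beta> t\<close> may vanish, and the divisions by it would lose their meaning.\<close>

definition regular :: "real \<Rightarrow> bool" where "regular t \<longleftrightarrow> 0 < t \<and> 0 < m t"

lemma regular_measurable[measurable]: "Measurable.pred borel regular"
  unfolding regular_def by measurable

lemma sets_layer_distr[simp, measurable_cong]: "sets (layer_distr f) = sets borel"
  by (simp add: layer_distr_def)

lemma AE_regular: "AE t in layer_distr f. regular t"
proof -
  note measurable_emeasure_superlevel[of f, measurable]
  show ?thesis
    unfolding layer_distr_def
    by (subst AE_density) (auto simp: regular_def emeasure_superlevel split: split_indicator_asm)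
qed

text \<open>A zero scale would confine the layer to the origin, contradicting its positive
  volume.\<close>

lemma \<beta>_pos:
  assumes "regular t" shows "0 < \<beta> t"
proof (rule ccontr)
  assume "\<not> 0 < \<beta> t"
  hence "\<beta> t = 0" using \<beta>_nonneg[of t] assms by (simp add: regular_def)
  hence "superlevel f t \<subseteq> {0}" using cover[of t] assms by (auto simp: regular_def)
  hence "emeasure lborel (superlevel f t) \<le> emeasure lborel {0 :: real^'n}" by (intro emeasure_mono) auto
  thus False using assms emeasure_superlevel[of t] by (simp add: regular_def)
qed

text \<open>The volume of the layer relative to that of the scaled cell, which is the probability
  that one trial is accepted.\<close>

definition acc :: "real \<Rightarrow> real" where "acc t = m t / (\<beta> t ^ CARD('n) * vol)"

lemma emeasure_preimage:
  assumes "regular t"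
  shows "emeasure lborel {z. \<beta> t *\<^sub>R z \<in> superlevel f t} = ennreal (m t / \<beta> t ^ CARD('n))"
proof -
  have b: "0 < \<beta> t" by (rule \<beta>_pos[OF assms])
  let ?E = "{z. \<beta> t *\<^sub>R z \<in> superlevel f t}"
  have E[measurable]: "?E \<in> sets borel" by measurable
  have "(\<lambda>z. \<beta> t *\<^sub>R z + 0) ` ?E = superlevel f t"
    using b by (auto simp: image_iff intro!: exI[of _ "_ /\<^sub>R \<beta> t"])
  hence "ennreal (m t) = ennreal (\<beta> t ^ CARD('n)) * emeasure lborel ?E"
    using emeasure_lebesgue_affine[of "\<beta> t" 0 ?E] emeasure_superlevel[of t] assms b
    by (simp add: regular_def ennreal_power)
  hence "ennreal (1 / \<beta> t ^ CARD('n)) * ennreal (m t) =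
      (ennreal (1 / \<beta> t ^ CARD('n)) * ennreal (\<beta> t ^ CARD('n))) * emeasure lborel ?E"
    by (simp add: mult.assoc)
  thus ?thesis using b assms by (simp add: ennreal_mult[symmetric] regular_def)
qed

lemma preimage_subset:
  assumes "regular t" shows "{z. \<beta> t *\<^sub>R z \<in> superlevel f t} \<subseteq> P"
  using \<beta>_pos[OF assms] cover[of t] assms by (auto simp: regular_def)

lemma acc_bounds:
  assumes "regular t" shows "0 < acc t" "acc t \<le> 1"
proof -
  have b: "0 < \<beta> t" by (rule \<beta>_pos[OF assms])
  show "0 < acc t" using b vol_pos assms by (simp add: acc_def regular_def)
  have "emeasure lborel {z. \<beta> t *\<^sub>R z \<in> superlevel f t} \<le> emeasure lborel P"
    using preimage_subset[OF assms] by (intro emeasure_mono) auto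
  hence "m t / \<beta> t ^ CARD('n) \<le> vol"
    using vol_pos by (simp add: emeasure_preimage[OF assms] emeasure_P)
  thus "acc t \<le> 1" using b vol_pos by (simp add: acc_def field_simps)
qed

section \<open>The trials of the rejection sampler\<close>

definition trial :: "real^'n \<Rightarrow> real \<Rightarrow> real^'n \<Rightarrow> real^'n" where
  "trial x t v = \<beta> t *\<^sub>R (cell_quantizer G P (x /\<^sub>R \<beta> t - v) + v)"

definition trial_index :: "real^'n \<Rightarrow> real \<Rightarrow> (nat \<Rightarrow> real^'n) \<Rightarrow> nat" where
  "trial_index x t v = (LEAST i. trial x t (v i) - x \<in> superlevel f t)"

lemma lrsuq_eq: "lrsuq G P f \<beta> x (t, v) = trial x t (v (trial_index x t v))"
  by (simp add: lrsuq_def trial_def trial_index_def Let_def)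

lemma trial_minus:
  assumes "0 < \<beta> t"
  shows "trial x t v - x = \<beta> t *\<^sub>R (cell_quantizer G P (x /\<^sub>R \<beta> t - v) + v - x /\<^sub>R \<beta> t)"
  using assms by (simp add: trial_def scaleR_diff_right)

text \<open>The first fact puts the output on a shifted lattice determined by \<open>v\<close> and
  \<open>t\<close>, the second keeps it near the input; together they provide the setting for
  packing. Both hold for accepted and rejected trials alike.\<close>

lemma trial_mem:
  assumes "0 < \<beta> t"
  shows "\<exists>l\<in>\<Lambda>. trial x t v = \<beta> t *\<^sub>R (l + v)" "\<exists>p\<in>P. trial x t v = x + \<beta> t *\<^sub>R p"
proof -
  show "\<exists>l\<in>\<Lambda>. trial x t v = \<beta> t *\<^sub>R (l + v)"
    using quantizer_mem(1) by (auto simp: trial_def)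
  show "\<exists>p\<in>P. trial x t v = x + \<beta> t *\<^sub>R p"
    using quantizer_mem(2)[of "x /\<^sub>R \<beta> t - v"] trial_minus[OF assms, of x v]
    by (intro bexI[of _ "cell_quantizer G P (x /\<^sub>R \<beta> t - v) + v - x /\<^sub>R \<beta> t"]) (auto simp: algebra_simps)
qed

lemma prob_space_uniform_P: "prob_space (uniform_measure lborel P)"
  using emeasure_P_pos emeasure_P_finite by (intro prob_space_uniform_measure) auto

text \<open>After division by \<open>\<beta> t\<close> the error of a trial is uniform on
  \<open>P\<close> by the folding lemma, so acceptance has the probability of the scaled-down layer,
  exactly \<open>acc t\<close>.\<close>

lemma emeasure_reject:
  assumes t: "regular t"
  shows "emeasure (uniform_measure lborel P) {v. trial x t v - x \<notin> superlevel f t} \<le> ennreal (1 - acc t)"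
proof -
  interpret U: prob_space "uniform_measure lborel P" by (rule prob_space_uniform_P)
  have b: "0 < \<beta> t" by (rule \<beta>_pos[OF t])
  define E where "E = {z. \<beta> t *\<^sub>R z \<in> superlevel f t}"
  have [measurable]: "E \<in> sets borel" unfolding E_def by measurable
  let ?A = "{v. trial x t v - x \<in> superlevel f t}"
  have A[measurable]: "?A \<in> sets borel" unfolding trial_def by measurable
  have "P \<inter> ?A = {v \<in> P. cell_quantizer G P (x /\<^sub>R \<beta> t - v) + v - x /\<^sub>R \<beta> t \<in> E}"
    by (auto simp: E_def trial_minus[OF b])
  hence "emeasure lborel (P \<inter> ?A) = ennreal (m t / \<beta> t ^ CARD('n))"
    using emeasure_fold[of E "x /\<^sub>R \<beta> t"] preimage_subset[OF t] emeasure_preimage[OF t]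
    by (simp add: E_def[symmetric])
  hence "emeasure (uniform_measure lborel P) ?A = ennreal (acc t)"
    using vol_pos b t by (simp add: emeasure_P divide_ennreal acc_def regular_def)
  hence "U.prob ?A = acc t"
    using acc_bounds[OF t] by (simp add: U.emeasure_eq_measure)
  moreover have "{v. trial x t v - x \<notin> superlevel f t} = space (uniform_measure lborel P) - ?A" by auto
  ultimately have "U.prob {v. trial x t v - x \<notin> superlevel f t} = 1 - acc t"
    using U.prob_compl[of ?A] by simp
  thus ?thesis by (simp add: U.emeasure_eq_measure)
qed

lemma expected_trials:
  assumes t: "regular t"
  shows "(\<integral>\<^sup>+ v. ennreal (real (Suc (trial_index x t v))) \<partial>(\<Pi>\<^sub>M i\<in>UNIV. uniform_measure lborel P))
    \<le> ennreal (1 / acc t)"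
proof (rule nn_integral_stopping_time_le[OF prob_space_uniform_P _ emeasure_reject[OF t, of x] acc_bounds[OF t]])
  show "{v. trial x t v - x \<notin> superlevel f t} \<in> sets (uniform_measure lborel P)"
    unfolding trial_def by measurable
  fix v :: "nat \<Rightarrow> real^'n" and i j assume "j \<le> trial_index x t v" "i < j"
  \<comment> \<open>An index below \<open>LEAST\<close> never satisfies the predicate. This remains
    true when no trial is accepted and \<open>LEAST\<close> is an unspecified number, so that event
    needs no separate treatment.\<close>
  thus "v i \<in> {v. trial x t v - x \<notin> superlevel f t}"
    unfolding trial_index_def using not_less_Least[of i "\<lambda>i. trial x t (v i) - x \<in> superlevel f t"] by auto
qed

section \<open>Dilations of the input set\<close>

definition dilation :: "(real^'n) set \<Rightarrow> real \<Rightarrow> ennreal" where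
  "dilation X t = emeasure lebesgue (X + (\<lambda>b. (3 * \<eta> * \<beta> t) *\<^sub>R b) ` cball 0 1)"

lemma plus_scaled_cball:
  fixes X :: "(real^'n) set"
  assumes "0 < r"
  shows "X + (\<lambda>b. r *\<^sub>R b) ` cball 0 1 = (\<Union>x\<in>X. cball x r)"
proof safe
  fix y assume "y \<in> X + (\<lambda>b. r *\<^sub>R b) ` cball 0 1"
  then obtain x b where "x \<in> X" "norm b \<le> 1" "y = x + r *\<^sub>R b" by (auto simp: set_plus_def)
  thus "y \<in> (\<Union>x\<in>X. cball x r)" using assms by (auto simp: dist_norm intro!: bexI[of _ x])
next
  fix x y assume x: "x \<in> X" "y \<in> cball x r"
  have "y = x + r *\<^sub>R ((y - x) /\<^sub>R r)" using assms by simp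
  moreover have "norm (y - x) / r \<le> 1" using x assms by (simp add: dist_norm norm_minus_commute)
  hence "(y - x) /\<^sub>R r \<in> cball 0 1" using assms by (simp add: divide_inverse mult.commute)
  ultimately show "y \<in> X + (\<lambda>b. r *\<^sub>R b) ` cball 0 1"
    using x by (metis set_plus_intro imageI)
qed

lemma dilation_eq:
  assumes "regular t"
  shows "dilation X t = emeasure lebesgue (\<Union>x\<in>X. cball x (3 * \<eta> * \<beta> t))"
  unfolding dilation_def using \<beta>_pos[OF assms] \<eta>_pos by (subst plus_scaled_cball) auto

text \<open>The layer translated to any point of \<open>X\<close> fits into the ball around that
  point. This makes \<open>log 2 (u / m t)\<close> nonnegative, so later conversions to
  \<open>ennreal\<close> lose nothing.\<close>

lemma m_le_dilation:
  assumes t: "regular t" and X: "X \<noteq> {}"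
  shows "ennreal (m t) \<le> dilation X t"
proof -
  have b: "0 < \<beta> t" by (rule \<beta>_pos[OF t])
  obtain x where x: "x \<in> X" using X by auto
  have "ennreal (m t) = emeasure lebesgue ((\<lambda>z. 1 *\<^sub>R z + x) ` superlevel f t)"
    using t by (subst emeasure_lebesgue_affine) (simp add: emeasure_superlevel regular_def)
  also have "\<dots> \<le> emeasure lebesgue (\<Union>x\<in>X. cball x (3 * \<eta> * \<beta> t))"
  proof (rule emeasure_mono)
    show "(\<lambda>z. 1 *\<^sub>R z + x) ` superlevel f t \<subseteq> (\<Union>x\<in>X. cball x (3 * \<eta> * \<beta> t))"
    proof safe
      fix z assume "z \<in> superlevel f t"
      then obtain p where p: "p \<in> P" "z = \<beta> t *\<^sub>R p" using cover[of t] t by (auto simp: regular_def)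
      have "norm z \<le> \<eta> * \<beta> t" using norm_le_\<eta>[OF p(1)] b by (simp add: p mult.commute)
      also have "\<dots> \<le> 3 * \<eta> * \<beta> t" using b \<eta>_pos by simp
      finally show "1 *\<^sub>R z + x \<in> (\<Union>x\<in>X. cball x (3 * \<eta> * \<beta> t))"
        using x by (auto simp: dist_norm intro!: bexI[of _ x])
    qed
    show "(\<Union>x\<in>X. cball x (3 * \<eta> * \<beta> t)) \<in> sets lebesgue"
      using b \<eta>_pos by (intro sets_lebesgue_Union_cball) simp
  qed
  finally show ?thesis by (simp add: dilation_eq[OF t])
qed

text \<open>On regular layers the dilation depends on \<open>t\<close> only through
  \<open>\<beta> t\<close>, and monotonically in the radius. Elsewhere \<open>\<beta> t\<close> need
  not be positive, so the measurable \<open>V\<close> is only required to agree on regular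
  layers.\<close>

lemma measurable_dilation_version:
  obtains V where "V \<in> borel_measurable borel" "\<And>t. regular t \<Longrightarrow> dilation X t = V t"
proof
  \<comment> \<open>The value 0 at nonpositive radii keeps \<open>W\<close> monotone on the whole
    line.\<close>
  define W where "W r = (if r > 0 then emeasure lebesgue (\<Union>x\<in>X. cball x r) else 0)" for r
  have "mono W"
    unfolding W_def mono_def
    by (auto intro!: emeasure_mono sets_lebesgue_Union_cball intro: order_trans)
  hence [measurable]: "W \<in> borel_measurable borel" by (rule borel_measurable_mono_ennreal)
  show "(\<lambda>t. W (3 * \<eta> * \<beta> t)) \<in> borel_measurable borel" by measurable
  show "dilation X t = W (3 * \<eta> * \<beta> t)" if "regular t" for t
    using dilation_eq[OF that] \<beta>_pos[OF that] \<eta>_pos by (simp add: W_def)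
qed

text \<open>The reference distribution first draws a trial number from the geometric distribution with
  success probability \<open>a / (1 + a)\<close>, then a point uniformly from the lattice points that this trial
  can produce. The choice of \<open>a / (1 + a)\<close> over the acceptance probability \<open>a\<close> gives every
  trial number positive mass even for \<open>a = 1\<close>, and \<open>log (1 + a) / a \<le> log e\<close> is still enough.\<close>

lemma shannon_entropy_given_state:
  fixes M :: "'a measure" and Y :: "'a \<Rightarrow> real^'n"
  assumes M: "prob_space M" and Y[measurable]: "Y \<in> borel_measurable M"
    and X: "AE \<omega> in M. Y \<omega> \<in> X" and t: "regular t"
    and u: "dilation X t = ennreal u" "0 < u"
  shows "shannon_entropy (distr M borel (\<lambda>\<omega>. lrsuq G P f \<beta> (Y \<omega>) (t, v)))
    \<le> (\<integral>\<^sup>+ \<omega>. ennreal (log 2 (u / m t)) + ennreal (real (Suc (trial_index (Y \<omega>) t v))) * ennreal (log 2 (1 + acc t)) \<partial>M)"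
proof -
  interpret prob_space M by fact
  have b: "0 < \<beta> t" by (rule \<beta>_pos[OF t])
  have a: "0 < acc t" "acc t \<le> 1" by (rule acc_bounds[OF t])+
  \<comment> \<open>The packing bound on the number of candidates of one trial: dilated volume over
    the volume of the scaled cell. It is a real number, not rounded to an integer.\<close>
  define N where "N = u / (\<beta> t ^ CARD('n) * vol)"
  have N: "0 < N" using u b vol_pos by (simp add: N_def)
  define g where "g k = acc t / (1 + acc t) ^ Suc k" for k :: nat
  have g: "0 < g k" for k using a by (simp add: g_def)
  have g_sums: "g sums 1"
  proof -
    have "(\<lambda>k. acc t / (1 + acc t) * (1 / (1 + acc t)) ^ k) sums (acc t / (1 + acc t) * (1 / (1 - 1 / (1 + acc t))))"
      using a by (intro sums_mult geometric_sums) simp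
    also have "(\<lambda>k. acc t / (1 + acc t) * (1 / (1 + acc t)) ^ k) = g"
      by (simp add: g_def fun_eq_iff power_divide)
    also have "acc t / (1 + acc t) * (1 / (1 - 1 / (1 + acc t))) = 1"
    proof -
      have "1 - 1 / (1 + acc t) = acc t / (1 + acc t)" using a by (simp add: field_simps)
      thus ?thesis using a by simp
    qed
    finally show ?thesis .
  qed
  \<comment> \<open>All outputs that trial \<open>k\<close> could produce from some input in
    \<open>X\<close>, with the dither \<open>v k\<close> fixed.\<close>
  define C where "C k = {y. (\<exists>l\<in>\<Lambda>. y = \<beta> t *\<^sub>R (l + v k)) \<and> (\<exists>x\<in>X. \<exists>p\<in>P. y = x + \<beta> t *\<^sub>R p)}" for k
  define A where "A = (\<Union>k. C k)"
  have cA: "countable A"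
  proof -
    have "countable ((\<lambda>l. \<beta> t *\<^sub>R (l + v k)) ` \<Lambda>)" for k using countable_\<Lambda> by simp
    moreover have "C k \<subseteq> (\<lambda>l. \<beta> t *\<^sub>R (l + v k)) ` \<Lambda>" for k by (auto simp: C_def)
    ultimately have "countable (C k)" for k by (meson countable_subset)
    thus ?thesis unfolding A_def by auto
  qed
  have CA: "C k \<subseteq> A" for k by (auto simp: A_def)
  have card_C: "emeasure (count_space A) (C k) \<le> ennreal N" for k
  proof -
    have c: "0 < \<beta> t ^ CARD('n) * vol" using b vol_pos by simp
    have "emeasure (count_space A) (C k) = emeasure (count_space UNIV) (C k)"
      by (subst (1 2) emeasure_count_space) (auto simp: A_def)
    also have "\<dots> = emeasure (count_space UNIV) (C k) * ennreal (\<beta> t ^ CARD('n) * vol) * ennreal (1 / (\<beta> t ^ CARD('n) * vol))"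
      using b vol_pos by (simp add: mult.assoc ennreal_mult[symmetric])
    also have "\<dots> \<le> dilation X t * ennreal (1 / (\<beta> t ^ CARD('n) * vol))"
      unfolding dilation_eq[OF t] 
      using emeasure_packing[OF b norm_le_\<eta> \<eta>_pos, of "C k" "v k" X]
      by (intro mult_right_mono) (auto simp: C_def)
    also have "\<dots> = ennreal N" using u c by (simp add: N_def ennreal_mult[symmetric])
    finally show ?thesis .
  qed
  \<comment> \<open>Weight \<open>1 / N\<close> replaces the reciprocal of the exact count, so the
    total mass may fall below 1. Candidate sets of different trials may overlap; the contributions
    then add, which keeps the lower bound \<open>g k / N\<close> on \<open>C k\<close>.\<close>
  define q where "q y = (\<Sum>k. g k / N * indicator (C k) y)" for y
  have summ: "summable (\<lambda>k. g k / N * indicator (C k) y)" for y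
  proof (rule summable_comparison_test)
    show "\<exists>n. \<forall>k\<ge>n. norm (g k / N * indicator (C k) y) \<le> g k / N"
      using N g by (auto simp: less_imp_le split: split_indicator)
    show "summable (\<lambda>k. g k / N)" using g_sums by (intro summable_divide) (auto simp: sums_iff)
  qed
  have q_ge: "g k / N \<le> q y" if "y \<in> C k" for y k
  proof -
    have "g k / N = (\<Sum>k\<in>{k}. g k / N * indicator (C k) y)" using that by simp
    also have "\<dots> \<le> q y"
      unfolding q_def using N g by (intro sum_le_suminf summ) (auto simp: less_imp_le)
    finally show ?thesis .
  qed
  have q_pos: "0 < q y" if y: "y \<in> A" for y
  proof -
    obtain k where "y \<in> C k" using y by (auto simp: A_def)
    from q_ge[OF this] show ?thesis using g[of k] N by (meson divide_pos_pos less_le_trans)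
  qed
  have q_sum: "(\<integral>\<^sup>+ y. ennreal (q y) \<partial>count_space A) \<le> 1"
  proof -
    have "(\<integral>\<^sup>+ y. ennreal (q y) \<partial>count_space A) = (\<integral>\<^sup>+ y. (\<Sum>k. ennreal (g k / N) * indicator (C k) y) \<partial>count_space A)"
    proof (rule nn_integral_cong)
      fix y
      have "ennreal (q y) = (\<Sum>k. ennreal (g k / N * indicator (C k) y))"
        unfolding q_def using N g by (intro suminf_ennreal2[symmetric] summ) (auto simp: less_imp_le)
      also have "\<dots> = (\<Sum>k. ennreal (g k / N) * indicator (C k) y)"
        by (intro suminf_cong) (auto split: split_indicator)
      finally show "ennreal (q y) = (\<Sum>k. ennreal (g k / N) * indicator (C k) y)" .
    qed
    also have "\<dots> = (\<Sum>k. ennreal (g k / N) * emeasure (count_space A) (C k))"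
      using CA by (subst nn_integral_suminf) (auto intro!: suminf_cong nn_integral_cmult_indicator)
    also have "\<dots> \<le> (\<Sum>k. ennreal (g k / N) * ennreal N)"
      by (intro suminf_le mult_left_mono card_C) auto
    also have "\<dots> = (\<Sum>k. ennreal (g k))"
      using N g by (intro suminf_cong) (simp add: ennreal_mult[symmetric] less_imp_le)
    also have "\<dots> = 1"
      using suminf_ennreal_eq[of g, OF less_imp_le[OF g] g_sums] by simp
    finally show ?thesis .
  qed
  have outC: "lrsuq G P f \<beta> x (t, v) \<in> C (trial_index x t v)" if "x \<in> X" for x
    using trial_mem[OF b, of x] that unfolding lrsuq_eq C_def by blast
  have [measurable]: "(\<lambda>x. lrsuq G P f \<beta> x (t, v)) \<in> borel_measurable borel"
  proof -
    have "(t, v) \<in> space (lrsuq_state P f)"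
      using sets_eq_imp_space_eq[OF sets_lrsuq_state] by (simp add: space_pair_measure space_PiM)
    from measurable_compose[OF measurable_Pair2'[OF this] measurable_lrsuq[OF f_borel \<beta>_borel]] show ?thesis by simp
  qed
  have "shannon_entropy (distr M borel (\<lambda>\<omega>. lrsuq G P f \<beta> (Y \<omega>) (t, v)))
      \<le> (\<integral>\<^sup>+ \<omega>. ennreal (- log 2 (q (lrsuq G P f \<beta> (Y \<omega>) (t, v)))) \<partial>M)"
    using X outC by (intro shannon_entropy_distr_le[OF M _ cA _ q_pos q_sum]) (auto simp: A_def)
  also have "\<dots> \<le> (\<integral>\<^sup>+ \<omega>. ennreal (log 2 (u / m t)) + ennreal (real (Suc (trial_index (Y \<omega>) t v))) * ennreal (log 2 (1 + acc t)) \<partial>M)"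
  proof (rule nn_integral_mono_AE, use X in eventually_elim)
    fix \<omega> assume \<omega>: "Y \<omega> \<in> X"
    define k where "k = trial_index (Y \<omega>) t v"
    let ?y = "lrsuq G P f \<beta> (Y \<omega>) (t, v)"
    have mt: "0 < m t" using t by (simp add: regular_def)
    have "- log 2 (q ?y) \<le> - log 2 (g k / N)"
      using q_ge[OF outC[OF \<omega>]] q_pos[OF subsetD[OF CA outC[OF \<omega>]]] g[of k] N by (simp add: k_def)
    also have "\<dots> = log 2 (u / m t * (1 + acc t) ^ Suc k)"
    proof -
      \<comment> \<open>The volume of the scaled cell cancels, since
        \<open>N / acc t = u / m t\<close>.\<close>
      have "inverse (g k / N) = u / m t * (1 + acc t) ^ Suc k"
        using a b vol_pos mt u by (simp add: g_def N_def acc_def field_simps)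
      thus ?thesis using g[of k] N by (subst log_inverse[symmetric]) auto
    qed
    also have "\<dots> = log 2 (u / m t) + real (Suc k) * log 2 (1 + acc t)"
      using a u mt by (subst log_mult) (auto simp: log_nat_power simp del: power_Suc of_nat_Suc)
    finally have "ennreal (- log 2 (q ?y)) \<le> ennreal (log 2 (u / m t) + real (Suc k) * log 2 (1 + acc t))"
      by (rule ennreal_leI)
    also have "\<dots> = ennreal (log 2 (u / m t)) + ennreal (real (Suc k) * log 2 (1 + acc t))"
    proof (rule ennreal_plus)
      have "X \<noteq> {}" using \<omega> by auto
      from m_le_dilation[OF t this] have "m t \<le> u" using u by simp
      thus "0 \<le> log 2 (u / m t)" using mt by simp
    qed (use a in simp)
    also have "\<dots> = ennreal (log 2 (u / m t)) + ennreal (real (Suc k)) * ennreal (log 2 (1 + acc t))"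
      using a by (subst ennreal_mult[symmetric]) auto
    finally show "ennreal (- log 2 (q ?y)) \<le> ennreal (log 2 (u / m t)) + ennreal (real (Suc (trial_index (Y \<omega>) t v))) * ennreal (log 2 (1 + acc t))"
      by (simp add: k_def)
  qed
  finally show ?thesis .
qed

end

section \<open>Averaging over the state\<close>

lemma measurable_elog2[measurable]: "elog2 \<in> borel_measurable borel"
  unfolding elog2_def by measurable

lemma ext_integral_cong_AE:
  assumes "AE x in M. g x = h x"
  shows "ext_integral M g = ext_integral M h"
proof -
  have "(\<integral>\<^sup>+ x. e2ennreal (g x) \<partial>M) = (\<integral>\<^sup>+ x. e2ennreal (h x) \<partial>M)"
    "(\<integral>\<^sup>+ x. e2ennreal (- g x) \<partial>M) = (\<integral>\<^sup>+ x. e2ennreal (- h x) \<partial>M)"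
    using assms by (auto intro!: nn_integral_cong_AE)
  thus ?thesis by (simp add: ext_integral_def)
qed

lemma ext_integral_eq_integral:
  fixes g :: "'a \<Rightarrow> real"
  assumes g: "integrable M g"
  shows "ext_integral M (\<lambda>x. ereal (g x)) = ereal (\<integral>x. g x \<partial>M)"
proof -
  have fin: "(\<integral>\<^sup>+ x. ennreal (g x) \<partial>M) \<noteq> \<infinity>" "(\<integral>\<^sup>+ x. ennreal (- g x) \<partial>M) \<noteq> \<infinity>"
    using g by (auto simp: real_integrable_def)
  then obtain p n where *: "(\<integral>\<^sup>+ x. ennreal (g x) \<partial>M) = ennreal p" "0 \<le> p"
      "(\<integral>\<^sup>+ x. ennreal (- g x) \<partial>M) = ennreal n" "0 \<le> n"
    by (metis ennreal_cases infinity_ennreal_def)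
  thus ?thesis
    using g by (simp add: ext_integral_def real_lebesgue_integral_def)
qed

text \<open>The identity that \<open>a - b\<close> is the difference of the signed parts, rearranged
  into sums of nonnegative terms so that it can be integrated even when some of them are
  infinite.\<close>

lemma e2ennreal_diff_add:
  assumes "ereal b \<le> a"
  shows "e2ennreal (a - ereal b) + e2ennreal (- a) + e2ennreal (ereal b)
    = e2ennreal a + e2ennreal (- ereal b)"
proof (cases a)
  case (real r)
  have "ennreal (r - b) + ennreal (- r) + ennreal b = ennreal r + ennreal (- b)" if "b \<le> r"
  proof -
    consider "0 \<le> b" | "b < 0" "0 \<le> r" | "r < 0" by linarith
    thus ?thesis
    proof cases
      case 1 thus ?thesis using that by (simp add: ennreal_neg ennreal_plus[symmetric] del: ennreal_plus)
    next
      case 2 thus ?thesis by (simp add: ennreal_neg ennreal_plus[symmetric] del: ennreal_plus)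
    next
      case 3 thus ?thesis using that by (simp add: ennreal_neg ennreal_plus[symmetric] del: ennreal_plus)
    qed
  qed
  thus ?thesis using real assms by simp
qed (use assms in auto)

text \<open>If \<open>ap\<close> is infinite, or \<open>bn\<close> is infinite while
  \<open>ap\<close> is finite, the right-hand side is \<open>\<infinity>\<close>. Otherwise the
  balance makes all five quantities finite and can be solved for \<open>i\<close>.\<close>

lemma ennreal_balance:
  fixes i ap an bp bn :: ennreal
  assumes eq: "i + an + bp = ap + bn" and le: "bp \<le> ap"
  shows "enn2ereal i \<le> (enn2ereal ap - enn2ereal an) - (enn2ereal bp - enn2ereal bn)"
proof -
  consider "ap = top" | "ap \<noteq> top" "bn = top" | "ap \<noteq> top" "bn \<noteq> top" by blast
  thus ?thesis
  proof cases
    case 2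
    hence "bp \<noteq> top" using le by (auto simp: top_unique)
    hence "enn2ereal bp - enn2ereal bn = - \<infinity>"
      unfolding 2(2) by (cases bp) auto
    thus ?thesis
      by (cases "enn2ereal ap - enn2ereal an") auto
  next
    case 3
    have "i + an + bp \<noteq> top" unfolding eq using 3 by simp
    hence "i \<noteq> top" "an \<noteq> top" "bp \<noteq> top" by auto
    then obtain i' an' bp' where 1: "i = ennreal i'" "0 \<le> i'" "an = ennreal an'" "0 \<le> an'"
        "bp = ennreal bp'" "0 \<le> bp'"
      by (cases i; cases an; cases bp) auto
    from 3 obtain ap' bn' where 2: "ap = ennreal ap'" "0 \<le> ap'" "bn = ennreal bn'" "0 \<le> bn'"
      by (cases ap; cases bn) auto
    have "ennreal (i' + an' + bp') = ennreal (ap' + bn')"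
      using eq 1 2 by simp
    hence "i' + an' + bp' = ap' + bn'"
      using 1(2,4,6) 2(2,4) by (subst (asm) ennreal_inj) auto
    thus ?thesis using 1 2 by simp
  qed simp
qed

text \<open>The convention \<open>\<infinity> - \<infinity> = \<infinity>\<close> makes the right-hand side infinite whenever the
  two integrals cannot be subtracted.\<close>

lemma nn_integral_diff_le_ext_integral:
  fixes A :: "'a \<Rightarrow> ereal" and B :: "'a \<Rightarrow> real"
  assumes [measurable]: "A \<in> borel_measurable M" "B \<in> borel_measurable M"
    and le: "AE x in M. ereal (B x) \<le> A x"
  shows "enn2ereal (\<integral>\<^sup>+ x. e2ennreal (A x - ereal (B x)) \<partial>M)
    \<le> ext_integral M A - ext_integral M (\<lambda>x. ereal (B x))"
proof -
  let ?I = "\<integral>\<^sup>+ x. e2ennreal (A x - ereal (B x)) \<partial>M"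
  let ?ap = "\<integral>\<^sup>+ x. e2ennreal (A x) \<partial>M" and ?an = "\<integral>\<^sup>+ x. e2ennreal (- A x) \<partial>M"
  let ?bp = "\<integral>\<^sup>+ x. e2ennreal (ereal (B x)) \<partial>M" and ?bn = "\<integral>\<^sup>+ x. e2ennreal (- ereal (B x)) \<partial>M"
  have "?I + ?an + ?bp = (\<integral>\<^sup>+ x. e2ennreal (A x - ereal (B x)) + e2ennreal (- A x) + e2ennreal (ereal (B x)) \<partial>M)"
    by (simp add: nn_integral_add)
  also have "\<dots> = (\<integral>\<^sup>+ x. e2ennreal (A x) + e2ennreal (- ereal (B x)) \<partial>M)"
    by (intro nn_integral_cong_AE, use le in eventually_elim) (rule e2ennreal_diff_add)
  also have "\<dots> = ?ap + ?bn"
    by (subst nn_integral_add) auto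
  finally have eq: "?I + ?an + ?bp = ?ap + ?bn" .
  have bp_le: "?bp \<le> ?ap"
    by (intro nn_integral_mono_AE, use le in eventually_elim) (rule e2ennreal_mono)
  show ?thesis
    unfolding ext_integral_def by (rule ennreal_balance[OF eq bp_le])
qed

section \<open>The bound on the conditional entropy\<close>

context layered_quantizer
begin

text \<open>The factor \<open>m t\<close> is the density of the layer variable, so the layered
  entropy is an expectation of \<open>log 2 (m t)\<close>. The change of measure is applied to the
  positive and the negative part separately.\<close>

lemma layered_entropy_eq:
  "layered_entropy f = ext_integral (layer_distr f) (\<lambda>t. ereal (log 2 (m t)))"
proof -
  note measurable_emeasure_superlevel[of f, measurable]
  have *: "(\<integral>\<^sup>+ t. ennreal (m t * g t) \<partial>restrict_space lborel {0<..}) = (\<integral>\<^sup>+ t. ennreal (g t) \<partial>layer_distr f)"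
    if [measurable]: "g \<in> borel_measurable borel" for g :: "real \<Rightarrow> real"
  proof -
    have "(\<integral>\<^sup>+ t. ennreal (m t * g t) \<partial>restrict_space lborel {0<..})
        = (\<integral>\<^sup>+ t. ennreal (m t * g t) * indicator {0<..} t \<partial>lborel)"
      by (subst nn_integral_restrict_space) auto
    also have "\<dots> = (\<integral>\<^sup>+ t. (indicator {0<..} t * emeasure lborel (superlevel f t)) * ennreal (g t) \<partial>lborel)"
      by (intro nn_integral_cong)
         (auto simp: emeasure_superlevel ennreal_mult' m_def split: split_indicator)
    also have "\<dots> = (\<integral>\<^sup>+ t. ennreal (g t) \<partial>layer_distr f)"
      unfolding layer_distr_def by (subst nn_integral_density) auto
    finally show ?thesis .
  qed
  show ?thesis
    unfolding layered_entropy_def ext_integral_def m_def[symmetric]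
    using *[of "\<lambda>t. log 2 (m t)"] *[of "\<lambda>t. - log 2 (m t)"] by simp
qed

lemma measurable_trial_index:
  "(\<lambda>z. trial_index (fst z) (fst (snd z)) (snd (snd z)))
    \<in> borel \<Otimes>\<^sub>M lrsuq_state P f \<rightarrow>\<^sub>M count_space UNIV"
proof -
  have "(\<lambda>z. trial_index (fst z) (fst (snd z)) (snd (snd z)))
    \<in> borel \<Otimes>\<^sub>M (borel \<Otimes>\<^sub>M (\<Pi>\<^sub>M i\<in>UNIV. borel)) \<rightarrow>\<^sub>M count_space UNIV"
  (is "_ \<in> ?N \<rightarrow>\<^sub>M _")
  proof -
    define y where "y i z = trial (fst z) (fst (snd z)) (snd (snd z) i)"
      for i and z :: "(real^'n) \<times> real \<times> (nat \<Rightarrow> real^'n)"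
    have [measurable]: "y i \<in> borel_measurable ?N" for i
      unfolding y_def trial_def by measurable
    have "(\<lambda>z. LEAST i. fst (snd z) \<le> f (y i z - fst z)) \<in> ?N \<rightarrow>\<^sub>M count_space UNIV"
      by measurable
    thus ?thesis by (simp add: trial_index_def superlevel_def y_def)
  qed
  also have "\<dots> = borel \<Otimes>\<^sub>M lrsuq_state P f \<rightarrow>\<^sub>M count_space UNIV"
    by (intro measurable_cong_sets sets_pair_measure_cong) (simp_all add: sets_lrsuq_state)
  finally show ?thesis .
qed

lemma prob_space_state: "prob_space (lrsuq_state P f)"
  unfolding lrsuq_state_def
  by (intro prob_space_pair prob_space_layer_distr prob_space_PiM prob_space_uniform_P pdf)

lemma acc_borel[measurable]: "acc \<in> borel_measurable borel"
  unfolding acc_def by measurable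

lemma space_state: "space (lrsuq_state P f) = UNIV"
  using sets_eq_imp_space_eq[OF sets_lrsuq_state] by (simp add: space_pair_measure space_PiM)

text \<open>The bound for a fixed state depends on the dithers only through the number of trials.
  Exchanging the averages over dithers and input lets the expected number of trials be bounded for
  each input separately.\<close>

lemma cond_entropy_le_nn_integral:
  fixes M :: "'a measure"
  assumes M: "prob_space M" and ind: "indep_rvs M borel Y (lrsuq_state P f) S"
    and dS: "distr M (lrsuq_state P f) S = lrsuq_state P f"
    and X: "AE \<omega> in M. Y \<omega> \<in> X"
    and V[measurable]: "V \<in> borel_measurable borel" and VX: "\<And>t. regular t \<Longrightarrow> dilation X t = V t"
  shows "cond_entropy M (lrsuq_state P f) (\<lambda>\<omega>. lrsuq G P f \<beta> (Y \<omega>) (S \<omega>)) S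
    \<le> (\<integral>\<^sup>+ t. e2ennreal (elog2 (V t) - ereal (log 2 (m t))) + ennreal (log 2 (exp 1)) \<partial>layer_distr f)"
proof -
  interpret M: prob_space M by fact
  interpret T: prob_space "layer_distr f" by (rule prob_space_layer_distr[OF pdf])
  let ?\<Pi> = "\<Pi>\<^sub>M i\<in>(UNIV :: nat set). uniform_measure lborel P"
  interpret \<Pi>: prob_space ?\<Pi> by (intro prob_space_PiM prob_space_uniform_P)
  interpret \<Pi>M: pair_sigma_finite ?\<Pi> M ..
  have Y[measurable]: "Y \<in> borel_measurable M" and S: "S \<in> M \<rightarrow>\<^sub>M lrsuq_state P f"
    using ind by (auto simp: indep_rvs_def)
  have Xne: "X \<noteq> {}" using X M.AE_False by auto
  have V_pos: "ennreal (m t) \<le> V t" if "regular t" for t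
    using m_le_dilation[OF that Xne] VX[OF that] by simp
  define h where "h \<omega> s = ennreal (log 2 (enn2real (V (fst s)) / m (fst s)))
      + ennreal (real (Suc (trial_index (Y \<omega>) (fst s) (snd s)))) * ennreal (log 2 (1 + acc (fst s)))" for \<omega> s
  \<comment> \<open>The value \<open>\<infinity>\<close> covers states without a finite bound:
    irregular layers form a null set, and where \<open>V\<close> is infinite the target bound is
    infinite too.\<close>
  define g where "g s = (if regular (fst s) \<and> V (fst s) < \<infinity> then \<integral>\<^sup>+ \<omega>. h \<omega> s \<partial>M else \<infinity>)" for s
  have fst_state[measurable]: "fst \<in> borel_measurable (lrsuq_state P f)"
    by (subst measurable_cong_sets[OF sets_lrsuq_state refl]) measurable
  have [measurable]: "(\<lambda>(s, \<omega>). h \<omega> s) \<in> borel_measurable (lrsuq_state P f \<Otimes>\<^sub>M M)"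
  proof -
    have [measurable]: "(\<lambda>p. trial_index (Y (snd p)) (fst (fst p)) (snd (fst p)))
        \<in> lrsuq_state P f \<Otimes>\<^sub>M M \<rightarrow>\<^sub>M count_space UNIV"
      using measurable_compose[of "\<lambda>p. (Y (snd p), fst p)" "lrsuq_state P f \<Otimes>\<^sub>M M" "borel \<Otimes>\<^sub>M lrsuq_state P f",
          OF _ measurable_trial_index] by simp
    show ?thesis unfolding h_def split_beta by measurable
  qed
  have g[measurable]: "g \<in> borel_measurable (lrsuq_state P f)"
    unfolding g_def by measurable
  have "cond_entropy M (lrsuq_state P f) (\<lambda>\<omega>. lrsuq G P f \<beta> (Y \<omega>) (S \<omega>)) S
      = (\<integral>\<^sup>+ s. shannon_entropy (distr M borel (\<lambda>\<omega>. lrsuq G P f \<beta> (Y \<omega>) s)) \<partial>lrsuq_state P f)"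
    using cond_entropy_eq[OF S M is_cond_distr_indep[OF M ind measurable_lrsuq[OF f_borel \<beta>_borel]]]
    by (simp add: dS)
  also have "\<dots> \<le> (\<integral>\<^sup>+ s. g s \<partial>lrsuq_state P f)"
  proof (rule nn_integral_mono)
    fix s
    show "shannon_entropy (distr M borel (\<lambda>\<omega>. lrsuq G P f \<beta> (Y \<omega>) s)) \<le> g s"
    proof (cases "regular (fst s) \<and> V (fst s) < \<infinity>")
      case True
      hence t: "regular (fst s)" by simp
      from True obtain u where u: "V (fst s) = ennreal u" "0 \<le> u" by (cases "V (fst s)") auto
      have "0 < u" using V_pos[OF t] t u by (auto simp: regular_def)
      with shannon_entropy_given_state[OF M Y X t _ this, of "snd s"] VX[OF t] u True
      show ?thesis by (simp add: g_def h_def)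
    next
      case False
      hence "g s = \<infinity>" unfolding g_def by (rule if_not_P)
      thus ?thesis by simp
    qed
  qed
  also have "\<dots> = (\<integral>\<^sup>+ t. (\<integral>\<^sup>+ v. g (t, v) \<partial>?\<Pi>) \<partial>layer_distr f)"
    using \<Pi>.nn_integral_fst[of g "layer_distr f"] g by (simp add: lrsuq_state_def)
  also have "\<dots> \<le> (\<integral>\<^sup>+ t. e2ennreal (elog2 (V t) - ereal (log 2 (m t))) + ennreal (log 2 (exp 1)) \<partial>layer_distr f)"
  proof (rule nn_integral_mono_AE, use AE_regular in eventually_elim)
    fix t assume t: "regular t"
    have mt: "0 < m t" using t by (simp add: regular_def)
    have a: "0 < acc t" by (rule acc_bounds[OF t])
    show "(\<integral>\<^sup>+ v. g (t, v) \<partial>?\<Pi>) \<le> e2ennreal (elog2 (V t) - ereal (log 2 (m t))) + ennreal (log 2 (exp 1))"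
    proof (cases "V t")
      case top
      thus ?thesis by (simp add: elog2_def)
    next
      case (real u)
      have u: "0 < u" using V_pos[OF t] mt real by auto
      let ?c = "ennreal (log 2 (u / m t))" and ?d = "ennreal (log 2 (1 + acc t))"
      have [measurable]: "(\<lambda>p. trial_index (Y (snd p)) t (fst p)) \<in> ?\<Pi> \<Otimes>\<^sub>M M \<rightarrow>\<^sub>M count_space UNIV"
      proof -
        have "(\<lambda>p. (Y (snd p), t, fst p)) \<in> ?\<Pi> \<Otimes>\<^sub>M M \<rightarrow>\<^sub>M borel \<Otimes>\<^sub>M lrsuq_state P f"
          unfolding lrsuq_state_def using sets_eq_imp_space_eq[OF sets_layer_distr]
          by (intro measurable_Pair measurable_const measurable_fst measurable_compose[OF measurable_snd Y]) auto
        from measurable_compose[OF this measurable_trial_index] show ?thesis by simp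
      qed
      have "(\<integral>\<^sup>+ v. g (t, v) \<partial>?\<Pi>) = (\<integral>\<^sup>+ v. (\<integral>\<^sup>+ \<omega>. ?c + ennreal (real (Suc (trial_index (Y \<omega>) t v))) * ?d \<partial>M) \<partial>?\<Pi>)"
        using t real by (simp add: g_def h_def)
      also have "\<dots> = (\<integral>\<^sup>+ \<omega>. (\<integral>\<^sup>+ v. ?c + ennreal (real (Suc (trial_index (Y \<omega>) t v))) * ?d \<partial>?\<Pi>) \<partial>M)"
        by (rule \<Pi>M.Fubini'[symmetric]) (simp only: case_prod_beta', measurable)
      also have "\<dots> \<le> (\<integral>\<^sup>+ \<omega>. ?c + ennreal (1 / acc t) * ?d \<partial>M)"
      proof (rule nn_integral_mono)
        fix \<omega> assume "\<omega> \<in> space M"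
        have [measurable]: "(\<lambda>v. trial_index (Y \<omega>) t v) \<in> ?\<Pi> \<rightarrow>\<^sub>M count_space UNIV"
        proof -
          have "(\<lambda>v. (Y \<omega>, t, v)) \<in> ?\<Pi> \<rightarrow>\<^sub>M borel \<Otimes>\<^sub>M lrsuq_state P f"
            unfolding lrsuq_state_def using sets_eq_imp_space_eq[OF sets_layer_distr]
            by (intro measurable_Pair measurable_const measurable_ident) auto
          from measurable_compose[OF this measurable_trial_index] show ?thesis by simp
        qed
        have "(\<integral>\<^sup>+ v. ?c + ennreal (real (Suc (trial_index (Y \<omega>) t v))) * ?d \<partial>?\<Pi>)
            = ?c + (\<integral>\<^sup>+ v. ennreal (real (Suc (trial_index (Y \<omega>) t v))) \<partial>?\<Pi>) * ?d"
          by (subst nn_integral_add, measurable)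
             (simp add: nn_integral_multc \<Pi>.emeasure_space_1 del: of_nat_Suc)
        also have "\<dots> \<le> ?c + ennreal (1 / acc t) * ?d"
          by (intro add_left_mono mult_right_mono expected_trials[OF t]) simp
        finally show "(\<integral>\<^sup>+ v. ?c + ennreal (real (Suc (trial_index (Y \<omega>) t v))) * ?d \<partial>?\<Pi>) \<le> \<dots>" .
      qed
      also have "\<dots> = ?c + ennreal (1 / acc t * log 2 (1 + acc t))"
        using a by (simp add: M.emeasure_space_1 ennreal_mult[symmetric])
      \<comment> \<open>This is \<open>ln (1 + a) \<le> a\<close>, and it is the source of the
        additive constant \<open>log 2 (exp 1)\<close>.\<close>
      also have "1 / acc t * log 2 (1 + acc t) \<le> log 2 (exp 1)"
        using ln_add_one_self_le_self[of "acc t"] a by (simp add: log_def field_simps)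
      hence "?c + ennreal (1 / acc t * log 2 (1 + acc t)) \<le> ?c + ennreal (log 2 (exp 1))"
        by (intro add_left_mono ennreal_leI)
      also have "?c = e2ennreal (elog2 (V t) - ereal (log 2 (m t)))"
        using real u mt by (simp add: elog2_def log_divide)
      finally show ?thesis .
    qed
  qed
  finally show ?thesis .
qed

lemma cond_entropy_le:
  fixes M :: "'a measure"
  assumes M: "prob_space M" and ind: "indep_rvs M borel Y (lrsuq_state P f) S"
    and dS: "distr M (lrsuq_state P f) S = lrsuq_state P f"
    and X: "AE \<omega> in M. Y \<omega> \<in> X"
  shows "enn2ereal (cond_entropy M (lrsuq_state P f) (\<lambda>\<omega>. lrsuq G P f \<beta> (Y \<omega>) (S \<omega>)) S)
    \<le> ext_integral (layer_distr f) (\<lambda>t. elog2 (dilation X t)) - layered_entropy f + ereal (log 2 (exp 1))"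
proof -
  interpret M: prob_space M by fact
  interpret T: prob_space "layer_distr f" by (rule prob_space_layer_distr[OF pdf])
  obtain V where V[measurable]: "V \<in> borel_measurable borel" and VX: "\<And>t. regular t \<Longrightarrow> dilation X t = V t"
    using measurable_dilation_version by blast
  have Xne: "X \<noteq> {}" using X M.AE_False by auto
  let ?I = "\<integral>\<^sup>+ t. e2ennreal (elog2 (V t) - ereal (log 2 (m t))) \<partial>layer_distr f"
  have "enn2ereal (cond_entropy M (lrsuq_state P f) (\<lambda>\<omega>. lrsuq G P f \<beta> (Y \<omega>) (S \<omega>)) S)
      \<le> enn2ereal (\<integral>\<^sup>+ t. e2ennreal (elog2 (V t) - ereal (log 2 (m t))) + ennreal (log 2 (exp 1)) \<partial>layer_distr f)"
    using cond_entropy_le_nn_integral[OF M ind dS X V VX] by (simp add: less_eq_ennreal.rep_eq)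
  also have "\<dots> = enn2ereal (?I + ennreal (log 2 (exp 1)))"
    by (subst nn_integral_add) (auto simp: T.emeasure_space_1)
  also have "\<dots> = enn2ereal ?I + ereal (log 2 (exp 1))"
    by (simp add: plus_ennreal.rep_eq log_def)
  also have "\<dots> \<le> ext_integral (layer_distr f) (\<lambda>t. elog2 (V t)) - layered_entropy f + ereal (log 2 (exp 1))"
    unfolding layered_entropy_eq
  proof (intro add_right_mono nn_integral_diff_le_ext_integral)
    show "AE t in layer_distr f. ereal (log 2 (m t)) \<le> elog2 (V t)"
      using AE_regular
    proof eventually_elim
      fix t assume t: "regular t"
      have mt: "0 < m t" using t by (simp add: regular_def)
      have "ennreal (m t) \<le> V t" using m_le_dilation[OF t Xne] VX[OF t] by simp
      thus "ereal (log 2 (m t)) \<le> elog2 (V t)"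
        using mt by (cases "V t") (auto simp: elog2_def)
    qed
  qed measurable
  also have "ext_integral (layer_distr f) (\<lambda>t. elog2 (V t)) = ext_integral (layer_distr f) (\<lambda>t. elog2 (dilation X t))"
    by (intro ext_integral_cong_AE, use AE_regular in eventually_elim) (simp add: VX)
  finally show ?thesis .
qed

end

section \<open>Normalized entropy\<close>

lemma indep_rvs_pair_measure:
  assumes A: "prob_space A" and B: "prob_space B" and sets: "sets A = sets N"
  shows "indep_rvs (A \<Otimes>\<^sub>M B) N fst B snd"
proof -
  interpret A: prob_space A by fact
  interpret B: prob_space B by fact
  interpret AB: prob_space "A \<Otimes>\<^sub>M B" by (rule prob_space_pair[OF A B])
  have fst[measurable]: "fst \<in> A \<Otimes>\<^sub>M B \<rightarrow>\<^sub>M N"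
    by (subst measurable_cong_sets[OF refl sets[symmetric]]) simp
  have eq: "fst -` a \<inter> space (A \<Otimes>\<^sub>M B) = a \<times> space B"
    "snd -` b \<inter> space (A \<Otimes>\<^sub>M B) = space A \<times> b" if "a \<in> sets A" "b \<in> sets B" for a b
    using sets.sets_into_space[OF that(1)] sets.sets_into_space[OF that(2)]
    by (auto simp: space_pair_measure)
  have Times: "AB.prob (a \<times> b) = A.prob a * B.prob b" if "a \<in> sets A" "b \<in> sets B" for a b
    using that B.emeasure_pair_measure_Times[of a A b]
    by (simp add: AB.emeasure_eq_measure A.emeasure_eq_measure B.emeasure_eq_measure
        ennreal_mult[symmetric])
  have "AB.prob ((a \<times> space B) \<inter> (space A \<times> b)) = AB.prob (a \<times> space B) * AB.prob (space A \<times> b)"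
    if "a \<in> sets A" "b \<in> sets B" for a b
  proof -
    have "(a \<times> space B) \<inter> (space A \<times> b) = a \<times> b"
      using sets.sets_into_space[OF that(1)] sets.sets_into_space[OF that(2)] by auto
    thus ?thesis using that by (simp add: Times A.prob_space B.prob_space)
  qed
  hence "AB.indep_set {fst -` a \<inter> space (A \<Otimes>\<^sub>M B) |a. a \<in> sets A} {snd -` b \<inter> space (A \<Otimes>\<^sub>M B) |b. b \<in> sets B}"
    using eq by (intro AB.indep_setI) (auto intro: measurable_sets)
  thus ?thesis by (simp add: indep_rvs_def sets[symmetric] fst)
qed

lemma distr_pair_snd:
  assumes "prob_space A" "sigma_finite_measure B"
  shows "distr (A \<Otimes>\<^sub>M B) B snd = B"
proof (rule measure_eqI)
  interpret A: prob_space A by fact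
  interpret B: sigma_finite_measure B by fact
  fix b assume "b \<in> sets (distr (A \<Otimes>\<^sub>M B) B snd)"
  hence b: "b \<in> sets B" by simp
  have "snd -` b \<inter> space (A \<Otimes>\<^sub>M B) = space A \<times> b"
    using sets.sets_into_space[OF b] by (auto simp: space_pair_measure)
  thus "emeasure (distr (A \<Otimes>\<^sub>M B) B snd) b = emeasure B b"
    using b by (simp add: emeasure_distr B.emeasure_pair_measure_Times A.emeasure_space_1)
qed simp

lemma Union_cball_cball:
  fixes r s :: real
  assumes "0 < r" "0 < s"
  shows "(\<Union>x\<in>cball 0 r. cball x s) = cball (0 :: 'b::real_normed_vector) (r + s)"
proof safe
  fix x y :: 'b assume "x \<in> cball 0 r" "y \<in> cball x s"
  thus "y \<in> cball 0 (r + s)"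
    using norm_triangle_ineq[of x "y - x"] by (simp add: dist_norm norm_minus_commute)
next
  fix y :: 'b assume y: "y \<in> cball 0 (r + s)"
  \<comment> \<open>The point dividing the segment from the origin to \<open>y\<close> in the ratio
    \<open>r : s\<close>.\<close>
  let ?x = "(r / (r + s)) *\<^sub>R y"
  have q: "norm y / (r + s) \<le> 1" using y assms by simp
  have "norm ?x \<le> r" using mult_left_mono[OF q, of r] assms by simp
  moreover have "?x - y = - ((s / (r + s)) *\<^sub>R y)"
  proof -
    have "s / (r + s) = 1 - r / (r + s)" using assms by (simp add: field_simps)
    thus ?thesis by (simp add: scaleR_diff_left)
  qed
  hence "dist ?x y \<le> s" using mult_left_mono[OF q, of s] assms by (simp add: dist_norm)
  ultimately show "y \<in> (\<Union>x\<in>cball 0 r. cball x s)"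
    by (intro UN_I[of ?x]) auto
qed

lemma elog2_ennreal: "0 < x \<Longrightarrow> elog2 (ennreal x) = ereal (log 2 x)"
  by (simp add: elog2_def)

section \<open>Inputs uniform on large balls\<close>

context layered_quantizer
begin

text \<open>Dilating a ball only enlarges its radius, so the volume gains a factor that is a power
  of \<open>1 + 3 * \<eta> * \<beta> t / \<tau>\<close> and the logarithm splits off the volume of
  the original ball.\<close>

lemma elog2_dilation_cball:
  assumes t: "regular t" and \<tau>: "0 < \<tau>"
  shows "elog2 (dilation (cball 0 \<tau>) t)
    = ereal (log 2 (measure lborel (cball (0 :: real^'n) \<tau>)) + CARD('n) * log 2 (1 + 3 * \<eta> * \<beta> t / \<tau>))"
proof -
  let ?s = "3 * \<eta> * \<beta> t" and ?u = "unit_ball_vol (real CARD('n))"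
  have s: "0 < ?s" using \<beta>_pos[OF t] \<eta>_pos by simp
  have u: "0 < ?u" by simp
  have "dilation (cball 0 \<tau>) t = emeasure lborel (cball (0 :: real^'n) (\<tau> + ?s))"
    using \<tau> s by (simp add: dilation_eq[OF t] Union_cball_cball)
  also have "\<dots> = ennreal (?u * (\<tau> + ?s) ^ CARD('n))"
    using \<tau> s by (subst emeasure_cball) auto
  also have "?u * (\<tau> + ?s) ^ CARD('n) = (?u * \<tau> ^ CARD('n)) * (1 + ?s / \<tau>) ^ CARD('n)"
    using \<tau> by (simp add: power_mult_distrib[symmetric] algebra_simps)
  finally have "dilation (cball 0 \<tau>) t = ennreal ((?u * \<tau> ^ CARD('n)) * (1 + ?s / \<tau>) ^ CARD('n))" .
  moreover have "0 < (?u * \<tau> ^ CARD('n)) * (1 + ?s / \<tau>) ^ CARD('n)"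
    using \<tau> u divide_pos_pos[OF s \<tau>] by (intro mult_pos_pos zero_less_power add_pos_pos) auto
  ultimately have "elog2 (dilation (cball 0 \<tau>) t) = ereal (log 2 ((?u * \<tau> ^ CARD('n)) * (1 + ?s / \<tau>) ^ CARD('n)))"
    by (simp only: elog2_ennreal)
  also have "log 2 ((?u * \<tau> ^ CARD('n)) * (1 + ?s / \<tau>) ^ CARD('n))
      = log 2 (?u * \<tau> ^ CARD('n)) + log 2 ((1 + ?s / \<tau>) ^ CARD('n))"
    using \<tau> u[THEN less_imp_neq, symmetric] divide_pos_pos[OF s \<tau>] by (subst log_mult) auto
  also have "log 2 ((1 + ?s / \<tau>) ^ CARD('n)) = CARD('n) * log 2 (1 + ?s / \<tau>)"
    using divide_pos_pos[OF s \<tau>] by (intro log_nat_power) simp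
  also have "?u * \<tau> ^ CARD('n) = measure lborel (cball (0 :: real^'n) \<tau>)"
    using \<tau> by (subst content_cball) auto
  finally show ?thesis .
qed

lemma normalized_entropy_le:
  assumes fin: "(\<integral>\<^sup>+ t. ennreal (log 2 (1 + \<beta> t)) \<partial>layer_distr f) < \<infinity>"
  shows "normalized_entropy (lrsuq_state P f) (lrsuq G P f \<beta>) \<le> - layered_entropy f + ereal (log 2 (exp 1))"
proof -
  interpret T: prob_space "layer_distr f" by (rule prob_space_layer_distr[OF pdf])
  interpret PS: prob_space "lrsuq_state P f" by (rule prob_space_state)
  \<comment> \<open>Equal to \<open>\<beta>\<close> on regular layers and nonnegative everywhere,
    which keeps the logarithms below meaningful for every \<open>t\<close>.\<close>
  define b where "b t = max 0 (\<beta> t)" for t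
  have [measurable]: "b \<in> borel_measurable borel" unfolding b_def by measurable
  have b0: "0 \<le> b t" for t by (simp add: b_def)
  have log_b: "0 \<le> log 2 (1 + b t)" for t
    using b0[of t] by (subst zero_le_log_cancel_iff) auto
  have b_eq: "b t = \<beta> t" if "regular t" for t using \<beta>_pos[OF that] by (simp add: b_def)
  define J where "J \<tau> t = log 2 (1 + 3 * \<eta> * b t / \<tau>)" for \<tau> t
  have J[measurable]: "J \<tau> \<in> borel_measurable borel" for \<tau> unfolding J_def by measurable
  have int_b: "integrable (layer_distr f) (\<lambda>t. log 2 (1 + b t))"
  proof (rule integrableI_nonneg)
    have "(\<integral>\<^sup>+ t. ennreal (log 2 (1 + b t)) \<partial>layer_distr f) = (\<integral>\<^sup>+ t. ennreal (log 2 (1 + \<beta> t)) \<partial>layer_distr f)"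
      by (intro nn_integral_cong_AE, use AE_regular in eventually_elim) (simp add: b_eq)
    thus "(\<integral>\<^sup>+ t. ennreal (log 2 (1 + b t)) \<partial>layer_distr f) < \<infinity>" using fin by simp
    show "AE t in layer_distr f. 0 \<le> log 2 (1 + b t)" by (rule AE_I2) (rule log_b)
  qed measurable
  \<comment> \<open>From \<open>3 * \<eta>\<close> on, the factor \<open>3 * \<eta> / \<tau>\<close>
    is at most 1, so one integrable function dominates all later \<open>J \<tau>\<close>.\<close>
  have J_bound: "\<bar>J \<tau> t\<bar> \<le> log 2 (1 + b t)" if "\<tau> \<ge> 3 * \<eta>" for \<tau> t
  proof -
    have \<tau>: "0 < \<tau>" using that \<eta>_pos by simp
    have "3 * \<eta> * b t / \<tau> \<le> b t"
      using mult_right_mono[OF that b0[of t]] \<tau> by (simp add: divide_le_eq mult.commute)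
    moreover have "0 \<le> 3 * \<eta> * b t / \<tau>" using \<tau> b0 \<eta>_pos by (intro divide_nonneg_pos mult_nonneg_nonneg) auto
    ultimately have "log 2 1 \<le> J \<tau> t" "J \<tau> t \<le> log 2 (1 + b t)" unfolding J_def by (auto simp del: log_one)
    thus ?thesis by simp
  qed
  have int_J: "integrable (layer_distr f) (J \<tau>)" if "\<tau> \<ge> 3 * \<eta>" for \<tau>
    by (rule Bochner_Integration.integrable_bound[OF int_b])
       (simp_all add: J_bound[OF that] abs_of_nonneg[OF log_b])
  define I where "I \<tau> = (\<integral>t. J \<tau> t \<partial>layer_distr f)" for \<tau>
  have "((\<lambda>\<tau>. \<integral>t. J \<tau> t \<partial>layer_distr f) \<longlongrightarrow> (\<integral>t. 0 \<partial>layer_distr f)) at_top"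
  proof (rule integral_dominated_convergence_at_top[OF _ _ int_b])
    show "AE t in layer_distr f. ((\<lambda>\<tau>. J \<tau> t) \<longlongrightarrow> 0) at_top"
    proof (rule AE_I2)
      fix t
      have "((\<lambda>\<tau>. 3 * \<eta> * b t / \<tau>) \<longlongrightarrow> 0) at_top"
        by (intro real_tendsto_divide_at_top[OF tendsto_const] filterlim_ident)
      hence "((\<lambda>\<tau>. log 2 (1 + 3 * \<eta> * b t / \<tau>)) \<longlongrightarrow> log 2 (1 + 0)) at_top"
        by (intro tendsto_log tendsto_add tendsto_const) auto
      thus "((\<lambda>\<tau>. J \<tau> t) \<longlongrightarrow> 0) at_top" by (simp add: J_def)
    qed
    show "\<forall>\<^sub>F \<tau> in at_top. AE t in layer_distr f. norm (J \<tau> t) \<le> log 2 (1 + b t)"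
      using eventually_ge_at_top[of "3 * \<eta>"] by eventually_elim (use J_bound in auto)
  qed (use J in auto)
  hence I: "(I \<longlongrightarrow> 0) at_top" by (simp add: I_def[abs_def])
  let ?c = "- layered_entropy f + ereal (log 2 (exp 1))"
  have lim: "((\<lambda>\<tau>. ereal (CARD('n) * I \<tau>) + ?c) \<longlongrightarrow> ?c) at_top"
  proof -
    have "((\<lambda>\<tau>. ereal (CARD('n) * I \<tau>)) \<longlongrightarrow> ereal (real CARD('n) * 0)) at_top"
      by (intro tendsto_ereal tendsto_mult tendsto_const I)
    \<comment> \<open>The constant \<open>?c\<close> may be infinite; the sum still converges
      because the other limit is finite.\<close>
    from tendsto_add_ereal_general2[OF _ this tendsto_const[of ?c]] show ?thesis by (simp add: zero_ereal_def[symmetric])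
  qed
  have bound: "enn2ereal (cond_entropy (uniform_measure lborel (cball 0 \<tau>) \<Otimes>\<^sub>M lrsuq_state P f) (lrsuq_state P f)
        (\<lambda>(x, s). lrsuq G P f \<beta> x s) snd) - ereal (log 2 (measure lborel (cball (0 :: real^'n) \<tau>)))
      \<le> ereal (CARD('n) * I \<tau>) + ?c" if \<tau>': "\<tau> \<ge> 3 * \<eta>" for \<tau>
  proof -
    have \<tau>: "0 < \<tau>" using that \<eta>_pos by simp
    let ?U = "uniform_measure lborel (cball (0 :: real^'n) \<tau>)"
    let ?L = "log 2 (measure lborel (cball (0 :: real^'n) \<tau>))"
    have U: "prob_space ?U"
      using \<tau> unit_ball_vol_pos[of "real CARD('n)", THEN less_imp_neq]
      by (intro prob_space_uniform_measure) (auto simp: emeasure_cball)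
    have "AE x in distr (?U \<Otimes>\<^sub>M lrsuq_state P f) ?U fst. x \<in> cball 0 \<tau>"
      unfolding PS.distr_pair_fst by (rule AE_uniform_measureI) auto
    hence AE: "AE \<omega> in ?U \<Otimes>\<^sub>M lrsuq_state P f. fst \<omega> \<in> cball 0 \<tau>"
      by (rule AE_distrD[rotated]) simp
    have "enn2ereal (cond_entropy (?U \<Otimes>\<^sub>M lrsuq_state P f) (lrsuq_state P f) (\<lambda>\<omega>. lrsuq G P f \<beta> (fst \<omega>) (snd \<omega>)) snd)
        \<le> ext_integral (layer_distr f) (\<lambda>t. elog2 (dilation (cball 0 \<tau>) t)) - layered_entropy f + ereal (log 2 (exp 1))"
      using U AE
      by (intro cond_entropy_le prob_space_pair indep_rvs_pair_measure distr_pair_snd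
          PS.prob_space_axioms PS.sigma_finite_measure_axioms) auto
    also have "ext_integral (layer_distr f) (\<lambda>t. elog2 (dilation (cball 0 \<tau>) t))
        = ext_integral (layer_distr f) (\<lambda>t. ereal (?L + CARD('n) * J \<tau> t))"
      by (intro ext_integral_cong_AE, use AE_regular in eventually_elim)
         (simp add: elog2_dilation_cball[OF _ \<tau>] J_def b_eq)
    also have "\<dots> = ereal (\<integral>t. ?L + CARD('n) * J \<tau> t \<partial>layer_distr f)"
      using int_J[OF \<tau>'] by (intro ext_integral_eq_integral) auto
    also have "(\<integral>t. ?L + CARD('n) * J \<tau> t \<partial>layer_distr f) = ?L + CARD('n) * I \<tau>"
      using int_J[OF \<tau>'] by (simp add: I_def T.prob_space)
    finally have "enn2ereal (cond_entropy (?U \<Otimes>\<^sub>M lrsuq_state P f) (lrsuq_state P f)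
        (\<lambda>(x, s). lrsuq G P f \<beta> x s) snd)
        \<le> ereal (?L + CARD('n) * I \<tau>) - layered_entropy f + ereal (log 2 (exp 1))"
      by (simp add: case_prod_beta')
    \<comment> \<open>The log-volume is a finite real and cancels; the case split deals with
      infinite entropies.\<close>
    thus ?thesis
      by (cases "layered_entropy f"; cases "enn2ereal (cond_entropy (?U \<Otimes>\<^sub>M lrsuq_state P f) (lrsuq_state P f)
        (\<lambda>(x, s). lrsuq G P f \<beta> x s) snd)") auto
  qed
  have "normalized_entropy (lrsuq_state P f) (lrsuq G P f \<beta>) \<le> Limsup at_top (\<lambda>\<tau>. ereal (CARD('n) * I \<tau>) + ?c)"
    unfolding normalized_entropy_def
    by (intro Limsup_mono eventually_mono[OF eventually_ge_at_top[of "3 * \<eta>"]] bound)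
  also have "\<dots> = ?c" by (rule lim_imp_Limsup[OF _ lim]) simp
  finally show ?thesis .
qed

end

theorem theorem16:
  fixes G :: "real^'n^'n" and P :: "(real^'n) set"
    and f :: "real^'n \<Rightarrow> real" and \<beta> :: "real \<Rightarrow> real" and \<eta> :: real
  assumes "invertible G"
    and "basic_cell G P" and "P \<in> sets borel"
    and "is_pdf f"
    and "\<And>t. t > 0 \<Longrightarrow> bounded (superlevel f t)"
    and "\<beta> \<in> borel_measurable borel"
    and "\<And>t. t > 0 \<Longrightarrow> \<beta> t \<ge> 0"
    and "\<And>t. t > 0 \<Longrightarrow> superlevel f t \<subseteq> (\<lambda>p. \<beta> t *\<^sub>R p) ` P"
    and "\<eta> = (SUP x\<in>P. norm x)"
  shows
    "(\<forall>(M :: 'a measure) X S \<X>.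
        prob_space M \<and>
        indep_rvs M borel X (lrsuq_state P f) S \<and>
        distr M (lrsuq_state P f) S = lrsuq_state P f \<and>
        \<X> \<in> sets lebesgue \<and> emeasure lebesgue \<X> < \<infinity> \<and>
        (AE \<omega> in M. X \<omega> \<in> \<X>)
      \<longrightarrow>
        enn2ereal (cond_entropy M (lrsuq_state P f) (\<lambda>\<omega>. lrsuq G P f \<beta> (X \<omega>) (S \<omega>)) S)
          \<le> ext_integral (layer_distr f)
               (\<lambda>t. elog2 (emeasure lebesgue (\<X> + (\<lambda>b. (3 * \<eta> * \<beta> t) *\<^sub>R b) ` cball 0 1)))
             - layered_entropy f + ereal (log 2 (exp 1))) \<and>
     ((\<integral>\<^sup>+ t. ennreal (log 2 (1 + \<beta> t)) \<partial>layer_distr f) < \<infinity>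
      \<longrightarrow> normalized_entropy (lrsuq_state P f) (lrsuq G P f \<beta>)
            \<le> - layered_entropy f + ereal (log 2 (exp 1)))"
proof -
  interpret layered_quantizer G P f \<beta> \<eta>
    using assms(2-9) by unfold_locales
  show ?thesis
    using cond_entropy_le normalized_entropy_le unfolding dilation_def by blast
qed

end
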